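(* Consider the two-stage reservation/walk-in allocation model, with the DASS-I policy $\hat\pi_1$ in Stage I, the DASS-II policy $\hat\pi_2$ with parameter $\alpha$ and confirmation time $v$ in Stage II, and the decoupled single-day offline optimal Stage II policy $\hat\pi_2^\star$ (all defined in the context). For any $k\in[T]$, given the number of non-cancelled bookings $B^{(k)}$ from Stage I, by setting $\alpha<1/2$, the expected Stage II loss difference between $\hat\pi_2$ and $\hat\pi_2^\star$ on Day $k$ is bounded by $$\mathbb E_{\mathcal F_{\rm II}^{(k)}}\Big[\mathcal L_{\rm II}^{(k)}\big(\hat\pi_2,\{B^{(k')}(\hat\pi_1)\}_{k'=1}^k\big)-\mathcal L_{\rm II}^{(k)}\big(\hat\pi_2^\star,\{B^{(k')}(\hat\pi_1)\}_{k'=1}^k\big)\Big]=O\Big(\lambda^{(2,k)}_{[0,v]}\cdot\exp\big(-\Omega(\lambda^{(2,k)}_{[v,1]})\big)\Big),$$ where $\lambda^{(2,k)}_{[0,v]}=\int_0^v\lambda^{(2,k)}(s)\,ds$ and $\lambda^{(2,k)}_{[v,1]}=\int_v^1\lambda^{(2,k)}(s)\,ds$ are the walk-in rates before and after the confirmation time $v$. That is, the regret decays exponentially with the post-confirmation walk-in rate $\lambda^{(2,k)}_{[v,1]}$.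
   Context: **Model.** $[n]=\{1,\dots,n\}$. There are $T$ service days, capacity $C$ (identical rooms, reusable), and a maximum advance booking window of $k_0\in\mathbb N$ days. Day $k$ is the time interval $[k,k+1)$. The confidence parameter $\iota$ is of order $\log(CT)$. *Stage I (reservations for Day $k$).* Booking requests (Type I customers) arrive on $[k-k_0,k]$ as a Poisson process with time-varying rate $\lambda^{(1,k)}(t)$; $\Lambda^{(1,k)}$ is their number. A reservation made at time $t$ is kept through Stage I (until time $k$) with probability $p^{(k)}(t)$, independently across customers, where $p^{(k)}:[k-k_0,k]\to[0,1]$ is nondecreasing with $p^{(k)}(k)=1$; $Y^{(0,k)}_i\in\{0,1\}$ indicates that request $i$ is kept ($1$) or cancelled ($0$) in Stage I. The integrated rate of non-cancelled Type I customers is $\lambda^{(1,k)}=\int_{k-k_0}^k\lambda^{(1,k)}(t)p^{(k)}(t)\,dt$. The policy $\pi_1$ immediately accepts ($z_i^{(0,k)}=1$) or rejects ($z_i^{(0,k)}=0$) each request; overbooking is allowed. $B^{(k)}=B^{(k)}(\pi_1)=\sum_{i\le\Lambda^{(1,k)}}Y_i^{(0,k)}z_i^{(0,k)}$. *Stage II (check-in on Day $k$).* Each of the $B^{(k)}$ remaining Type I customers has a time $X_i^{(1,k)}\in[0,1]$ (time within the day) with density $\gamma^{(k)}$ at which check-in or cancellation occurs, and $Y_i^{(1,k)}\sim\mathrm{Bernoulli}(q^{(1,k)})$ ($1$ = check-in, $0$ = cancellation). Walk-ins (Type II customers, who do not cancel) arrive on $[0,1]$ as a Poisson process with rate $\lambda^{(2,k)}(u)$;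 $\Lambda^{(2,k)}$ is their number and $\lambda^{(2,k)}=\int_0^1\lambda^{(2,k)}(u)\,du$. Each customer has an occupancy duration $D$ in days, observed on request/arrival, either $D\sim\mathrm{Geometric}(q)$ or $D\equiv d\in\mathbb N$ constant. The Stage II policy $\pi_2$ accepts or rejects each arriving Type I customer ($z_i^{(1,k)}\in\{0,1\}$) and each walk-in ($z_i^{(2,k)}\in\{0,1\}$), subject to $\mathrm{Occ}^{(k)}\le C$ for all $k\in[T]$, where $$\mathrm{Occ}^{(k)}=\sum_{k'=1}^k\Big(\sum_{i\le B^{(k')}}Y_i^{(1,k')}z_i^{(1,k')}\mathbf 1\{D_i^{(1,k')}\ge k-k'\}+\sum_{i\le\Lambda^{(2,k')}}z_i^{(2,k')}\mathbf 1\{D_i^{(2,k')}\ge k-k'\}\Big).$$ $\mathcal F_{\rm II}^{(k)}$ denotes all realized Stage II information up to and including Day $k$. *Confirmation call.* At time $k+v$ of Day $k$ ($v$ a predetermined constant) the decision maker learns which remaining reservations for Day $k$ will show up; the confirmation rate is $q^{(1,k)}=p^{(k)}(k+v)$ (with $p^{(k)}$ capped at $1$ after time $k$). *Loss.* With overbooking loss $\ell^{(k)}$ and revenue $r^{(k)}$, $$\mathcal L_{\rm II}^{(k)}\big(\pi_2,\{B^{(k')}(\pi_1)\}_{k'=1}^k\big)=\ell^{(k)}\sum_{i\le B^{(k)}}Y_i^{(1,k)}(1-z_i^{(1,k)})+r^{(k)}\big(C-\mathrm{Occ}^{(k)}\big).$$ *DASS-I policy $\hat\pi_1$.* For each day $k$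 the estimated capacity is $$\hat C^{(k)}=C-\frac{1-q}{q}\Big[\lambda^{(1,k)}-\frac{4\iota}{3}-\sqrt{\frac{8\iota^2}{3}+\frac{2\iota(1-q)}{q}\lambda^{(1,k)}}\Big]\quad\text{(geometric)},$$ $$\hat C^{(k)}=C-d\Big[\lambda^{(1,k)}-\frac{4\iota}{3}-\sqrt{\frac{8\iota^2}{3}+2\iota\lambda^{(1,k)}}\Big]\quad\text{(constant)}.$$ Let $B_t^{(k)}$ be the number of accepted reservations for Day $k$ not yet cancelled at time $t$, and $$\hat B_t^{(k)}=p^{(k)}(t)B_t^{(k)}+\frac{\iota(1-p^{(k)}(t))}{3}+\sqrt{\Big(\frac{\iota(1-p^{(k)}(t))}{3}\Big)^2+2\iota B_t^{(k)}p^{(k)}(t)(1-p^{(k)}(t))}.$$ A booking request for Day $k$ arriving at time $t$ is accepted if $\hat B_t^{(k)}<\hat C^{(k)}$ and rejected otherwise. *Room capacity $\tilde C^{(k)}$.* For geometric duration, $$\tilde C^{(k)}=C-\sum_{k'=1}^{k-1}\Big(\sum_{i\le B^{(k')}}Y_i^{(1,k')}z_i^{(1,k')}\mathbf 1\{D_i^{(1,k')}\ge k-k'\}+\sum_{i\le\Lambda^{(2,k')}}z_i^{(2,k')}\mathbf 1\{D_i^{(2,k')}\ge k-k'\}\Big);$$ for constant duration, $\tilde C^{(k)}=C/d$. *Decoupled offline optimal policy $\hat\pi_2^\star=\hat\pi_2^{(1)\star}\times\cdots\times\hat\pi_2^{(T)\star}$.* On Day $k$, $\hat\pi_2^{(k)\star}$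 minimizes the Day-$k$ loss $\mathcal L_{\rm II}^{(k)}$ over all offline policies with full access to Stage I and Stage II information up to Day $k$ (including the results of earlier decisions), subject to $\sum_{i\le B^{(k)}}Y_i^{(1,k)}z_i^{(1,k)}+\sum_{i\le\Lambda^{(2,k)}}z_i^{(2,k)}\le\tilde C^{(k)}$. *DASS-II policy $\hat\pi_2$ (tunable parameter $0<\alpha<1$).* On Day $k$, for $u\in[0,1]$ let $B_{1,u}^{(k)}$ and $B_{2,u}^{(k)}$ be the numbers of Type I customers who checked in, respectively cancelled, during $[0,u]$, $W_{1,u}^{(k)}$ the number of walk-ins accepted in that period, and $B_{3,v}^{(k)}$ the number of Type I customers that will check in after time $v$, revealed by the confirmation call. Put $$\hat N_u^{(k)}=\begin{cases}B_{1,u}^{(k)}+q^{(1,k)}\big(B^{(k)}-B_{1,u}^{(k)}-B_{2,u}^{(k)}\big)+W_{1,u}^{(k)}+\alpha\int_u^1\lambda^{(2,k)}(s)\,ds,&0\le u<v,\\ B_{1,v}^{(k)}+B_{3,v}^{(k)}+W_{1,u}^{(k)},&u\ge v.\end{cases}$$ A walk-in arriving at time $u$ is accepted only if $\hat N_u^{(k)}<\tilde C^{(k)}$; a Type I customer arriving at time $u$ is given a room if $B_{1,u}^{(k)}+W_{1,u}^{(k)}<\tilde C^{(k)}$.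
   Formalization: The hidden constants depend on α and on a bound ρ for q(1-q)B^(k)/max(1, λ_[v,1]), with q the confirmation rate, up to a factor ℓ+r; fully uniform constants are impossible (e.g. C=B=n, q=1/2, λ_[0,v]=n, λ_[v,1]=√n gives regret of order √n). *)

theory Defs
  imports "HOL-Probability.Probability"
begin

text \<open>
  Customers are indexed from 0, days from 1. Times of requests and of cancellations in Stage I are
  absolute (day \<open>k\<close> is \<open>[k, k+1)\<close>); times within Stage II of a given day are relative to that day,
  in \<open>[0,1]\<close>.
\<close>

datatype duration = Geometric real | Constant nat

text \<open>
  \<open>Geometric q\<close> counts the failures before the first success, so its mean is \<open>(1 - q) / q\<close>; this is
  the convention under which \<open>est_capacity\<close> below subtracts the mean number of earlier guests.
\<close>

fun duration_pmf :: "duration \<Rightarrow> nat pmf" where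
  "duration_pmf (Geometric q) = geometric_pmf q"
| "duration_pmf (Constant d) = return_pmf d"

record params =
  horizon :: nat
  capacity :: nat
  window :: nat
  confirm_time :: real
  duration :: duration
  confidence :: real
  req_rate :: "nat \<Rightarrow> real \<Rightarrow> real"
  keep_prob :: "nat \<Rightarrow> real \<Rightarrow> real"
  check_density :: "nat \<Rightarrow> real \<Rightarrow> real"
  walk_rate :: "nat \<Rightarrow> real \<Rightarrow> real"
  over_loss :: "nat \<Rightarrow> real"
  revenue :: "nat \<Rightarrow> real"

text \<open>
  After time \<open>k\<close> the function \<open>keep_prob P k\<close> is only required to take values in \<open>[0,1]\<close>, so that
  \<open>confirm_rate P k\<close> can be any number in \<open>[0,1]\<close>, including 1.
\<close>

definition confirm_rate :: "params \<Rightarrow> nat \<Rightarrow> real" where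
  "confirm_rate P k = keep_prob P k (real k + confirm_time P)"

definition walk_mass :: "params \<Rightarrow> nat \<Rightarrow> real \<Rightarrow> real \<Rightarrow> real" where
  "walk_mass P k a b = (LBINT u:{a..b}. walk_rate P k u)"

definition kept_mass :: "params \<Rightarrow> nat \<Rightarrow> real" where
  "kept_mass P k =
     (LBINT t:{real k - real (window P)..real k}. req_rate P k t * keep_prob P k t)"

definition valid_params :: "params \<Rightarrow> bool" where
  "valid_params P \<longleftrightarrow>
     0 \<le> confirm_time P \<and> confirm_time P \<le> 1 \<and> 0 \<le> confidence P \<and>
     (case duration P of Geometric q \<Rightarrow> 0 < q \<and> q \<le> 1 | Constant d \<Rightarrow> 1 \<le> d) \<and>
     (\<forall>k\<in>{1..horizon P}.
        (\<forall>t. 0 \<le> req_rate P k t) \<and>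
        set_integrable lborel {real k - real (window P)..real k} (req_rate P k) \<and>
        (\<forall>t. 0 \<le> keep_prob P k t \<and> keep_prob P k t \<le> 1) \<and>
        mono_on {real k - real (window P)..real k} (keep_prob P k) \<and>
        keep_prob P k (real k) = 1 \<and>
        (\<forall>u. 0 \<le> check_density P k u) \<and> (\<forall>u. u \<notin> {0..1} \<longrightarrow> check_density P k u = 0) \<and>
        (\<forall>u. 0 \<le> walk_rate P k u) \<and> (\<forall>u. u \<notin> {0..1} \<longrightarrow> walk_rate P k u = 0) \<and>
        set_integrable lborel {0..1} (walk_rate P k) \<and>
        0 \<le> over_loss P k \<and> 0 \<le> revenue P k)"


section \<open>Poisson arrivals\<close>

definition arrivals_in :: "('s \<Rightarrow> nat) \<Rightarrow> (nat \<Rightarrow> 's \<Rightarrow> real) \<Rightarrow> real \<Rightarrow> real \<Rightarrow> 's \<Rightarrow> nat" where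
  "arrivals_in N X s t \<omega> = card {i. i < N \<omega> \<and> s < X i \<omega> \<and> X i \<omega> \<le> t}"

text \<open>
  The points \<open>X 0 \<le> X 1 \<le> \<dots>\<close> (\<open>N\<close> of them) form a Poisson process on \<open>[a,b]\<close>. The probabilities are
  written out because \<open>poisson_pmf\<close> excludes mass 0.
\<close>

definition poisson_arrivals ::
  "'s measure \<Rightarrow> ('s \<Rightarrow> nat) \<Rightarrow> (nat \<Rightarrow> 's \<Rightarrow> real) \<Rightarrow> real \<Rightarrow> real \<Rightarrow> (real \<Rightarrow> real) \<Rightarrow> bool" where
  "poisson_arrivals M N X a b rate \<longleftrightarrow>
     N \<in> measurable M (count_space UNIV) \<and> (\<forall>i. X i \<in> borel_measurable M) \<and>
     (AE \<omega> in M. (\<forall>i<N \<omega>. a < X i \<omega> \<and> X i \<omega> \<le> b) \<and>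
        (\<forall>i j. i \<le> j \<and> j < N \<omega> \<longrightarrow> X i \<omega> \<le> X j \<omega>)) \<and>
     (\<forall>s t n. a \<le> s \<and> s \<le> t \<and> t \<le> b \<longrightarrow>
        measure M {\<omega> \<in> space M. arrivals_in N X s t \<omega> = n} =
          (LBINT u:{s..t}. rate u) ^ n / fact n * exp (- (LBINT u:{s..t}. rate u))) \<and>
     (\<forall>m (\<tau> :: nat \<Rightarrow> real). mono \<tau> \<and> range \<tau> \<subseteq> {a..b} \<longrightarrow>
        prob_space.indep_vars M (\<lambda>_. count_space UNIV)
          (\<lambda>j. arrivals_in N X (\<tau> j) (\<tau> (Suc j))) {..<m})"


section \<open>Stage I\<close>

text \<open>
  \<open>cancel_time \<omega> k i\<close> is the time at which request \<open>i\<close> for day \<open>k\<close> is (or would be) cancelled; a value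
  beyond \<open>k\<close> means that it is kept through Stage I. The auxiliary uniform marks \<open>req_mark\<close> express
  that, given the arrival times, the requests are kept independently with probability
  \<open>keep_prob P k t\<close>. The law of the cancellation times of cancelled requests is left open.
\<close>

record stage1 =
  req_num :: "nat \<Rightarrow> nat"
  req_time :: "nat \<Rightarrow> nat \<Rightarrow> real"
  req_mark :: "nat \<Rightarrow> nat \<Rightarrow> real"
  cancel_time :: "nat \<Rightarrow> nat \<Rightarrow> real"

datatype source1 = Requests nat | Req_Mark nat nat

fun source1_day :: "source1 \<Rightarrow> nat" where
  "source1_day (Requests k) = k"
| "source1_day (Req_Mark k i) = k"

fun source1_events :: "stage1 measure \<Rightarrow> source1 \<Rightarrow> stage1 set set" where
  "source1_events M (Requests k) =
     sets (vimage_algebra (space M) (\<lambda>\<omega>. (req_num \<omega> k, req_time \<omega> k))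
       (count_space UNIV \<Otimes>\<^sub>M (\<Pi>\<^sub>M i\<in>UNIV. borel)))"
| "source1_events M (Req_Mark k i) =
     sets (vimage_algebra (space M) (\<lambda>\<omega>. req_mark \<omega> k i) borel)"

definition stage1_law :: "params \<Rightarrow> stage1 measure \<Rightarrow> bool" where
  "stage1_law P M \<longleftrightarrow> prob_space M \<and>
     (\<forall>k\<in>{1..horizon P}.
        poisson_arrivals M (\<lambda>\<omega>. req_num \<omega> k) (\<lambda>i \<omega>. req_time \<omega> k i)
          (real k - real (window P)) (real k) (req_rate P k) \<and>
        (\<forall>i. (\<lambda>\<omega>. req_mark \<omega> k i) \<in> borel_measurable M \<and>
             distr M lborel (\<lambda>\<omega>. req_mark \<omega> k i) = uniform_measure lborel {0..1} \<and>
             (\<lambda>\<omega>. cancel_time \<omega> k i) \<in> borel_measurable M) \<and>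
        (AE \<omega> in M. \<forall>i<req_num \<omega> k.
           req_time \<omega> k i \<le> cancel_time \<omega> k i \<and>
           (real k < cancel_time \<omega> k i \<longleftrightarrow> req_mark \<omega> k i \<le> keep_prob P k (req_time \<omega> k i)))) \<and>
     prob_space.indep_sets M (source1_events M) {s. source1_day s \<in> {1..horizon P}}"

definition est_capacity :: "params \<Rightarrow> nat \<Rightarrow> real" where
  "est_capacity P k =
     (let \<iota> = confidence P; m = kept_mass P k in
      case duration P of
        Geometric q \<Rightarrow> real (capacity P) - (1 - q) / q *
          (m - 4 * \<iota> / 3 - sqrt (8 * \<iota>\<^sup>2 / 3 + 2 * \<iota> * (1 - q) / q * m))
      | Constant d \<Rightarrow> real (capacity P) - real d *
          (m - 4 * \<iota> / 3 - sqrt (8 * \<iota>\<^sup>2 / 3 + 2 * \<iota> * m)))"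

definition booking_bound :: "params \<Rightarrow> nat \<Rightarrow> real \<Rightarrow> nat \<Rightarrow> real" where
  "booking_bound P k t n =
     (let \<iota> = confidence P; p = keep_prob P k t in
      p * real n + \<iota> * (1 - p) / 3 + sqrt ((\<iota> * (1 - p) / 3)\<^sup>2 + 2 * \<iota> * real n * p * (1 - p)))"

text \<open>The requests accepted by DASS-I among the first \<open>n\<close> requests for day \<open>k\<close>.\<close>

primrec dass1_accepted :: "params \<Rightarrow> stage1 \<Rightarrow> nat \<Rightarrow> nat \<Rightarrow> nat set" where
  "dass1_accepted P \<omega> k 0 = {}"
| "dass1_accepted P \<omega> k (Suc i) =
     (let A = dass1_accepted P \<omega> k i; t = req_time \<omega> k i in
      if booking_bound P k t (card {j\<in>A. t < cancel_time \<omega> k j}) < est_capacity P k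
      then insert i A else A)"

definition bookings :: "params \<Rightarrow> stage1 \<Rightarrow> nat \<Rightarrow> nat" where
  "bookings P \<omega> k =
     card {i \<in> dass1_accepted P \<omega> k (req_num \<omega> k). real k < cancel_time \<omega> k i}"


section \<open>Stage II\<close>

text \<open>
  The remaining Type I customers of day \<open>k\<close> are the \<open>i < B k\<close>; \<open>check_time\<close> is the time at which such
  a customer checks in (if \<open>shows_up\<close>) or cancels.
\<close>

record stage2 =
  check_time :: "nat \<Rightarrow> nat \<Rightarrow> real"
  shows_up :: "nat \<Rightarrow> nat \<Rightarrow> bool"
  stay1 :: "nat \<Rightarrow> nat \<Rightarrow> nat"
  walk_num :: "nat \<Rightarrow> nat"
  walk_time :: "nat \<Rightarrow> nat \<Rightarrow> real"
  stay2 :: "nat \<Rightarrow> nat \<Rightarrow> nat"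

datatype source2 = Walk_Ins nat | Check_Time nat nat | Shows_Up nat nat | Stay1 nat nat | Stay2 nat nat

fun source2_day :: "source2 \<Rightarrow> nat" where
  "source2_day (Walk_Ins k) = k"
| "source2_day (Check_Time k i) = k"
| "source2_day (Shows_Up k i) = k"
| "source2_day (Stay1 k i) = k"
| "source2_day (Stay2 k i) = k"

fun source2_events :: "stage2 measure \<Rightarrow> source2 \<Rightarrow> stage2 set set" where
  "source2_events M (Walk_Ins k) =
     sets (vimage_algebra (space M) (\<lambda>\<omega>. (walk_num \<omega> k, walk_time \<omega> k))
       (count_space UNIV \<Otimes>\<^sub>M (\<Pi>\<^sub>M i\<in>UNIV. borel)))"
| "source2_events M (Check_Time k i) =
     sets (vimage_algebra (space M) (\<lambda>\<omega>. check_time \<omega> k i) borel)"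
| "source2_events M (Shows_Up k i) =
     sets (vimage_algebra (space M) (\<lambda>\<omega>. shows_up \<omega> k i) (count_space UNIV))"
| "source2_events M (Stay1 k i) =
     sets (vimage_algebra (space M) (\<lambda>\<omega>. stay1 \<omega> k i) (count_space UNIV))"
| "source2_events M (Stay2 k i) =
     sets (vimage_algebra (space M) (\<lambda>\<omega>. stay2 \<omega> k i) (count_space UNIV))"

definition stage2_law :: "params \<Rightarrow> stage2 measure \<Rightarrow> bool" where
  "stage2_law P M \<longleftrightarrow> prob_space M \<and>
     (\<forall>k\<in>{1..horizon P}.
        poisson_arrivals M (\<lambda>\<omega>. walk_num \<omega> k) (\<lambda>i \<omega>. walk_time \<omega> k i) 0 1 (walk_rate P k) \<and>
        (\<forall>i. distributed M lborel (\<lambda>\<omega>. check_time \<omega> k i) (\<lambda>u. ennreal (check_density P k u)) \<and>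
             (\<lambda>\<omega>. shows_up \<omega> k i) \<in> measurable M (count_space UNIV) \<and>
             distr M (count_space UNIV) (\<lambda>\<omega>. shows_up \<omega> k i) =
               measure_pmf (bernoulli_pmf (confirm_rate P k)) \<and>
             (\<lambda>\<omega>. stay1 \<omega> k i) \<in> measurable M (count_space UNIV) \<and>
             distr M (count_space UNIV) (\<lambda>\<omega>. stay1 \<omega> k i) = measure_pmf (duration_pmf (duration P)) \<and>
             (\<lambda>\<omega>. stay2 \<omega> k i) \<in> measurable M (count_space UNIV) \<and>
             distr M (count_space UNIV) (\<lambda>\<omega>. stay2 \<omega> k i) = measure_pmf (duration_pmf (duration P)))) \<and>
     prob_space.indep_sets M (source2_events M) {s. source2_day s \<in> {1..horizon P}}"

text \<open>
  A decision for one day says which customers are given a room. Only \<open>take1 z i\<close> for showing-up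
  \<open>i < B k\<close> and \<open>take2 z i\<close> for \<open>i < walk_num \<omega> k\<close> matter. A function from days to decisions,
  restricted to days up to \<open>k\<close>, is the history of decisions up to day \<open>k\<close>.
\<close>

record decision =
  take1 :: "nat \<Rightarrow> bool"
  take2 :: "nat \<Rightarrow> bool"

definition occupants ::
  "stage2 \<Rightarrow> (nat \<Rightarrow> nat) \<Rightarrow> (nat \<Rightarrow> decision) \<Rightarrow> nat \<Rightarrow> nat \<Rightarrow> nat" where
  "occupants \<omega> B z k k' =
     card {i. i < B k' \<and> shows_up \<omega> k' i \<and> take1 (z k') i \<and> k - k' \<le> stay1 \<omega> k' i} +
     card {i. i < walk_num \<omega> k' \<and> take2 (z k') i \<and> k - k' \<le> stay2 \<omega> k' i}"

definition occupancy ::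
  "stage2 \<Rightarrow> (nat \<Rightarrow> nat) \<Rightarrow> (nat \<Rightarrow> decision) \<Rightarrow> nat \<Rightarrow> nat" where
  "occupancy \<omega> B z k = (\<Sum>k'=1..k. occupants \<omega> B z k k')"

definition loss ::
  "params \<Rightarrow> stage2 \<Rightarrow> (nat \<Rightarrow> nat) \<Rightarrow> (nat \<Rightarrow> decision) \<Rightarrow> nat \<Rightarrow> real" where
  "loss P \<omega> B z k =
     over_loss P k * real (card {i. i < B k \<and> shows_up \<omega> k i \<and> \<not> take1 (z k) i}) +
     revenue P k * (real (capacity P) - real (occupancy \<omega> B z k))"

definition room_capacity ::
  "params \<Rightarrow> stage2 \<Rightarrow> (nat \<Rightarrow> nat) \<Rightarrow> (nat \<Rightarrow> decision) \<Rightarrow> nat \<Rightarrow> real" where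
  "room_capacity P \<omega> B z k =
     (case duration P of
        Geometric q \<Rightarrow> real (capacity P) - (\<Sum>k'=1..<k. real (occupants \<omega> B z k k'))
      | Constant d \<Rightarrow> real (capacity P) / real d)"


subsection \<open>DASS-II\<close>

text \<open>
  In the next two definitions \<open>b\<close> is the number of remaining reservations, \<open>c\<close> the room capacity, and
  \<open>w\<close> the number of walk-ins accepted before time \<open>u\<close>. Type I customers who check in are counted
  whether or not they get a room: once one of them is refused, \<open>c\<close> is reached and everybody later is
  refused, so counting only those with a room gives the same decisions.
\<close>

definition dass2_estimate ::
  "params \<Rightarrow> real \<Rightarrow> stage2 \<Rightarrow> nat \<Rightarrow> nat \<Rightarrow> real \<Rightarrow> nat \<Rightarrow> real" where
  "dass2_estimate P \<alpha> \<omega> k b u w =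
     (let v = confirm_time P;
          B1 = (\<lambda>x. real (card {i. i < b \<and> shows_up \<omega> k i \<and> check_time \<omega> k i \<le> x}));
          B2 = (\<lambda>x. real (card {i. i < b \<and> \<not> shows_up \<omega> k i \<and> check_time \<omega> k i \<le> x}));
          B3 = real (card {i. i < b \<and> shows_up \<omega> k i \<and> v < check_time \<omega> k i})
      in if u < v
         then B1 u + confirm_rate P k * (real b - B1 u - B2 u) + real w + \<alpha> * walk_mass P k u 1
         else B1 v + B3 + real w)"

primrec dass2_walk_ins ::
  "params \<Rightarrow> real \<Rightarrow> stage2 \<Rightarrow> nat \<Rightarrow> nat \<Rightarrow> real \<Rightarrow> nat \<Rightarrow> nat set" where
  "dass2_walk_ins P \<alpha> \<omega> k b c 0 = {}"
| "dass2_walk_ins P \<alpha> \<omega> k b c (Suc i) =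
     (let A = dass2_walk_ins P \<alpha> \<omega> k b c i in
      if dass2_estimate P \<alpha> \<omega> k b (walk_time \<omega> k i) (card A) < c then insert i A else A)"

text \<open>
  A Type I customer is compared with the rooms taken strictly before the check-in, i.e. the customer
  is not counted against himself.
\<close>

definition dass2_day ::
  "params \<Rightarrow> real \<Rightarrow> stage2 \<Rightarrow> nat \<Rightarrow> nat \<Rightarrow> real \<Rightarrow> decision" where
  "dass2_day P \<alpha> \<omega> k b c =
     (let A = dass2_walk_ins P \<alpha> \<omega> k b c (walk_num \<omega> k) in
      \<lparr>take1 = (\<lambda>i. real (card {j. j < b \<and> shows_up \<omega> k j \<and> check_time \<omega> k j < check_time \<omega> k i}) +
                     real (card {j\<in>A. walk_time \<omega> k j < check_time \<omega> k i}) < c),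
       take2 = (\<lambda>i. i \<in> A)\<rparr>)"

primrec dass2 ::
  "params \<Rightarrow> real \<Rightarrow> stage2 \<Rightarrow> (nat \<Rightarrow> nat) \<Rightarrow> nat \<Rightarrow> nat \<Rightarrow> decision" where
  "dass2 P \<alpha> \<omega> B 0 = (\<lambda>_. \<lparr>take1 = (\<lambda>_. False), take2 = (\<lambda>_. False)\<rparr>)"
| "dass2 P \<alpha> \<omega> B (Suc k) =
     (let h = dass2 P \<alpha> \<omega> B k in
      h(Suc k := dass2_day P \<alpha> \<omega> (Suc k) (B (Suc k)) (room_capacity P \<omega> B h (Suc k))))"


subsection \<open>Decoupled offline optimum\<close>

definition day_feasible ::
  "params \<Rightarrow> stage2 \<Rightarrow> (nat \<Rightarrow> nat) \<Rightarrow> (nat \<Rightarrow> decision) \<Rightarrow> nat \<Rightarrow> bool" where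
  "day_feasible P \<omega> B z k \<longleftrightarrow>
     real (card {i. i < B k \<and> shows_up \<omega> k i \<and> take1 (z k) i}) +
     real (card {i. i < walk_num \<omega> k \<and> take2 (z k) i}) \<le> room_capacity P \<omega> B z k"

text \<open>
  Given the history \<open>h\<close> of the days before \<open>k\<close>, the day-\<open>k\<close> decision is replaced by one that minimizes
  the realized day-\<open>k\<close> loss; it may depend on all of \<open>\<omega>\<close>. All minimizers have the same loss.
\<close>

definition offline_opt ::
  "params \<Rightarrow> stage2 \<Rightarrow> (nat \<Rightarrow> nat) \<Rightarrow> (nat \<Rightarrow> decision) \<Rightarrow> nat \<Rightarrow> nat \<Rightarrow> decision" where
  "offline_opt P \<omega> B h k =
     h(k := arg_min (\<lambda>z. loss P \<omega> B (h(k := z)) k) (\<lambda>z. day_feasible P \<omega> B (h(k := z)) k))"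

text \<open>
  The variance, given the reservations left after Stage I, of the number of them that check in. No
  bound of order \<open>walk_mass P k 0 v * exp (- c * walk_mass P k v 1)\<close> can be uniform in this quantity:
  when it is large compared with \<open>(walk_mass P k v 1)\<^sup>2\<close>, the show-ups deviate from their mean by more than the
  safety stock \<open>\<alpha> * walk_mass P k v 1\<close> with probability bounded away from 0. It is 0 when
  \<open>confirm_rate P k = 1\<close>.
\<close>

definition show_up_variance :: "params \<Rightarrow> stage1 \<Rightarrow> nat \<Rightarrow> real" where
  "show_up_variance P \<omega> k = confirm_rate P k * (1 - confirm_rate P k) * real (bookings P \<omega> k)"

end

theory Submission
  imports Defs
begin

text \<open>
  Let \<open>D u\<close> be the number of guests checking in after time \<open>u\<close> minus its conditional mean. Before the
  confirmation call the policy compares \<open>S - D u + w + \<alpha> * walk_mass P k u 1\<close> with the capacity, where \<open>S\<close>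
  is the total number of show-ups and \<open>w\<close> the number of accepted walk-ins; after the call it compares
  \<open>S + w\<close>. So a walk-in accepted before the call can only displace a show-up if \<open>D u\<close> exceeds the safety
  stock \<open>\<alpha> * walk_mass P k u 1\<close>. If walk-ins are lost and rooms stay empty, everybody after the last
  rejected walk-in was accepted, and the number of empty rooms is at most
  \<open>\<alpha> * walk_mass P k u 1 - D u - n\<close> with \<open>n\<close> the number of later arrivals. Both losses are thus bounded by sums
  over the walk-ins before the call of exponentials in \<open>D u\<close> and \<open>n\<close>. The show-ups are independent of
  everything else, so the exponential moments of \<open>D u\<close> can be taken first; the remaining sum over
  Poisson points is computed on a partition of the time before the call into pieces of
  mass at most 1.
\<close>

text \<open>The obstacle is dependence: acceptances depend on earlier outcomes, and the room
  capacity of day \<open>k\<close> depends on all days before. Both disappear because the pathwise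
  bounds hold for every nonnegative capacity and sum over all walk-ins before the call, accepted or
  not; only times, counts and \<open>show_up_excess\<close> remain. The last rejected walk-in has a
  random index, and the sum over all indices is what produces the factor
  \<open>walk_mass P k 0 (confirm_time P)\<close>. Both losses use one exponential tilt
  \<open>s\<close>. It costs s^2 times the show-up variance and gains, with L the mass after the
  call, s * \<alpha> * L for refusals and (1 - exp (- s) - s * \<alpha>) * L for vacancies. With a
  variance of order max 1 L, a small \<open>s\<close> lets the gains win. The partition is needed
  because \<open>poisson_arrivals\<close> speaks of counts in intervals, not of sums over points;
  pieces of mass at most 1 cost only a constant factor. The comparison with the offline optimum
  needs a nonnegative capacity, which holds almost surely by induction over the days.\<close>

lemma of_nat_card_lessThan:
  "of_nat (card {i. i < (n::nat) \<and> Q i}) = (\<Sum>i<n. of_bool (Q i) :: 'a :: semiring_1)"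
proof -
  have "{i. i < n \<and> Q i} = {..<n} \<inter> {i. Q i}" by auto
  then show ?thesis by (simp add: of_bool_def sum.If_cases)
qed

lemma card_lessThan_Collect_le: "card {i. i < (n::nat) \<and> Q i} \<le> n"
  using card_mono[of "{..<n}" "{i. i < n \<and> Q i}"] by auto

section \<open>Pathwise behaviour of DASS-II\<close>

definition show_ups :: "stage2 \<Rightarrow> nat \<Rightarrow> nat \<Rightarrow> nat" where
  "show_ups \<omega> k b = card {i. i < b \<and> shows_up \<omega> k i}"

text \<open>Once the check-in times are fixed, this is a sum of independent centered Bernoulli
  variables over the reservations still open at \<open>u\<close>.\<close>

definition show_up_excess :: "params \<Rightarrow> stage2 \<Rightarrow> nat \<Rightarrow> nat \<Rightarrow> real \<Rightarrow> real" where
  "show_up_excess P \<omega> k b u =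
     (\<Sum>j<b. of_bool (u < check_time \<omega> k j) * (of_bool (shows_up \<omega> k j) - confirm_rate P k))"

text \<open>A reservation settled by time \<open>u\<close> enters the estimate with its outcome, an
  open one with its mean. The difference from \<open>show_ups\<close> is therefore outcome minus
  mean, summed over the open ones.\<close>

lemma dass2_estimate_before:
  assumes "u < confirm_time P"
  shows "dass2_estimate P \<alpha> \<omega> k b u w =
    real (show_ups \<omega> k b) - show_up_excess P \<omega> k b u + real w + \<alpha> * walk_mass P k u 1"
proof -
  let ?q = "confirm_rate P k"
  have "(\<Sum>i<b. of_bool (shows_up \<omega> k i \<and> check_time \<omega> k i \<le> u)) +
      ?q * (real b - (\<Sum>i<b. of_bool (shows_up \<omega> k i \<and> check_time \<omega> k i \<le> u))
        - (\<Sum>i<b. of_bool (\<not> shows_up \<omega> k i \<and> check_time \<omega> k i \<le> u)))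
    = (\<Sum>i<b. of_bool (shows_up \<omega> k i)) - show_up_excess P \<omega> k b u"
  proof (induction b)
    case (Suc b)
    then show ?case
      by (auto simp: show_up_excess_def algebra_simps)
  qed (simp add: show_up_excess_def)
  then show ?thesis
    using assms unfolding dass2_estimate_def Let_def show_ups_def of_nat_card_lessThan by simp
qed

lemma dass2_estimate_after:
  assumes "\<not> u < confirm_time P"
  shows "dass2_estimate P \<alpha> \<omega> k b u w = real (show_ups \<omega> k b) + real w"
proof -
  let ?v = "confirm_time P"
  have "real (show_ups \<omega> k b) = real (card {i. i < b \<and> shows_up \<omega> k i \<and> check_time \<omega> k i \<le> ?v})
     + real (card {i. i < b \<and> shows_up \<omega> k i \<and> ?v < check_time \<omega> k i})"
    unfolding show_ups_def of_nat_card_lessThan sum.distrib[symmetric] by (intro sum.cong) auto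
  then show ?thesis
    unfolding dass2_estimate_def Let_def if_not_P[OF assms] by linarith
qed

text \<open>Feeds the feasibility bound \<open>dass2_taken_le\<close>: a walk-in that passes the
  test finds fewer than \<open>c\<close> rooms claimed by earlier show-ups and walk-ins. Open
  reservations and the safety stock only enlarge the estimate.\<close>

lemma dass2_estimate_ge_arrived:
  assumes q: "0 \<le> confirm_rate P k" and m: "0 \<le> \<alpha> * walk_mass P k u 1"
  shows "real (card {i. i < b \<and> shows_up \<omega> k i \<and> check_time \<omega> k i \<le> u}) + real w
    \<le> dass2_estimate P \<alpha> \<omega> k b u w"
proof (cases "u < confirm_time P")
  case True
  define x y where "x = real (card {i. i < b \<and> shows_up \<omega> k i \<and> check_time \<omega> k i \<le> u})"
    and "y = real (card {i. i < b \<and> \<not> shows_up \<omega> k i \<and> check_time \<omega> k i \<le> u})"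
  have "x + y =
     (\<Sum>i<b. of_bool (shows_up \<omega> k i \<and> check_time \<omega> k i \<le> u) + of_bool (\<not> shows_up \<omega> k i \<and> check_time \<omega> k i \<le> u))"
    unfolding x_def y_def of_nat_card_lessThan sum.distrib ..
  also have "\<dots> \<le> (\<Sum>i<b. 1)" by (intro sum_mono) auto
  finally have "0 \<le> confirm_rate P k * (real b - x - y)"
    using q by (intro mult_nonneg_nonneg) auto
  then show ?thesis
    using m unfolding dass2_estimate_def Let_def if_P[OF True] x_def y_def by linarith
next
  case False
  have "card {i. i < b \<and> shows_up \<omega> k i \<and> check_time \<omega> k i \<le> u} \<le> show_ups \<omega> k b"
    unfolding show_ups_def by (rule card_mono) auto
  then show ?thesis unfolding dass2_estimate_after[OF False] by linarith
qed

lemma dass2_walk_ins_subset: "dass2_walk_ins P \<alpha> \<omega> k b c n \<subseteq> {..<n}"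
  by (induction n) (auto simp: Let_def less_Suc_eq)

lemma finite_dass2_walk_ins [simp]: "finite (dass2_walk_ins P \<alpha> \<omega> k b c n)"
  by (rule finite_subset[OF dass2_walk_ins_subset]) simp

text \<open>Decisions are never revised, so later steps leave the trace on earlier indices
  unchanged.\<close>

lemma dass2_walk_ins_Int:
  "i \<le> n \<Longrightarrow> dass2_walk_ins P \<alpha> \<omega> k b c n \<inter> {..<i} = dass2_walk_ins P \<alpha> \<omega> k b c i"
proof (induction n)
  case (Suc n)
  show ?case
  proof (cases "i = Suc n")
    case True
    then show ?thesis using dass2_walk_ins_subset[of P \<alpha> \<omega> k b c "Suc n"] by auto
  next
    case False
    then have "i \<le> n" using Suc.prems by simp
    then show ?thesis using Suc.IH by (auto simp: Let_def)
  qed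
qed simp

lemma mem_dass2_walk_ins_iff:
  assumes "i < n"
  shows "i \<in> dass2_walk_ins P \<alpha> \<omega> k b c n \<longleftrightarrow>
    dass2_estimate P \<alpha> \<omega> k b (walk_time \<omega> k i) (card (dass2_walk_ins P \<alpha> \<omega> k b c i)) < c"
proof -
  have "i \<in> dass2_walk_ins P \<alpha> \<omega> k b c n \<longleftrightarrow> i \<in> dass2_walk_ins P \<alpha> \<omega> k b c (Suc i)"
    using dass2_walk_ins_Int[of "Suc i" n P \<alpha> \<omega> k b c] assms by auto
  also have "\<dots> \<longleftrightarrow> dass2_estimate P \<alpha> \<omega> k b (walk_time \<omega> k i) (card (dass2_walk_ins P \<alpha> \<omega> k b c i)) < c"
    using dass2_walk_ins_subset[of P \<alpha> \<omega> k b c i] by (auto simp: Let_def)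
  finally show ?thesis .
qed

section \<open>Refusals and vacancies of DASS-II on one path, for a given capacity\<close>

context
  fixes P :: params and \<alpha> :: real and \<omega> :: stage2 and k b :: nat and c :: real
  fixes N S :: nat and A :: "nat set" and z :: decision and w :: "nat \<Rightarrow> nat"
  defines "N \<equiv> walk_num \<omega> k" and "S \<equiv> show_ups \<omega> k b"
    and "A \<equiv> dass2_walk_ins P \<alpha> \<omega> k b c (walk_num \<omega> k)"
    and "z \<equiv> dass2_day P \<alpha> \<omega> k b c"
    and "w \<equiv> \<lambda>i. card (dass2_walk_ins P \<alpha> \<omega> k b c i)"
begin

private lemma take1_eq: "take1 z i \<longleftrightarrow>
   real (card {j. j < b \<and> shows_up \<omega> k j \<and> check_time \<omega> k j < check_time \<omega> k i}) +
     real (card {j\<in>A. walk_time \<omega> k j < check_time \<omega> k i}) < c"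
  unfolding z_def A_def dass2_day_def Let_def by simp

private lemma take2_eq: "take2 z i \<longleftrightarrow> i \<in> A"
  unfolding z_def A_def dass2_day_def Let_def by simp

private lemma finA: "finite A" and AN: "A \<subseteq> {..<N}"
  unfolding A_def N_def using dass2_walk_ins_subset by auto

private lemma mem_A_below: "m < N \<Longrightarrow> i \<in> A \<Longrightarrow> i < m \<Longrightarrow> i \<in> dass2_walk_ins P \<alpha> \<omega> k b c m"
  using dass2_walk_ins_Int[of m N P \<alpha> \<omega> k b c] unfolding A_def N_def by fastforce

lemma dass2_taken2: "{i. i < N \<and> take2 z i} = A"
  using AN by (auto simp: take2_eq)

private lemma mem_A: "i < N \<Longrightarrow> i \<in> A \<longleftrightarrow> dass2_estimate P \<alpha> \<omega> k b (walk_time \<omega> k i) (w i) < c"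
  unfolding A_def N_def w_def by (rule mem_dass2_walk_ins_iff)

text \<open>The witness is the earliest check-in time among the refused show-ups; that refusal says
  that the claims strictly before it already reach \<open>c\<close>.\<close>

private lemma first_refused:
  assumes "{i. i < b \<and> shows_up \<omega> k i \<and> \<not> take1 z i} \<noteq> {}"
  shows "\<exists>x. c \<le> real (card {j. j < b \<and> shows_up \<omega> k j \<and> check_time \<omega> k j < x}) + real (card {j\<in>A. walk_time \<omega> k j < x})
    \<and> (\<forall>i<b. shows_up \<omega> k i \<longrightarrow> \<not> take1 z i \<longrightarrow> x \<le> check_time \<omega> k i)"
proof -
  let ?R = "{i. i < b \<and> shows_up \<omega> k i \<and> \<not> take1 z i}"
  have fin: "finite (check_time \<omega> k ` ?R)" by simp
  have ne: "check_time \<omega> k ` ?R \<noteq> {}" using assms by blast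
  define x where "x = Min (check_time \<omega> k ` ?R)"
  have "x \<in> check_time \<omega> k ` ?R"
    unfolding x_def by (rule Min_in[OF fin ne])
  then obtain i where i: "\<not> take1 z i" "x = check_time \<omega> k i" by blast
  show ?thesis
  proof (intro exI conjI allI impI)
    show "c \<le> real (card {j. j < b \<and> shows_up \<omega> k j \<and> check_time \<omega> k j < x}) + real (card {j\<in>A. walk_time \<omega> k j < x})"
      using i(1) unfolding i(2) take1_eq by (rule leI)
    fix j assume "j < b" "shows_up \<omega> k j" "\<not> take1 z j"
    then have "check_time \<omega> k j \<in> check_time \<omega> k ` ?R" by blast
    then show "x \<le> check_time \<omega> k j"
      unfolding x_def by (rule Min_le[OF fin])
  qed
qed

text \<open>Counting at the first refusal gives at most S + |A| - c refusals. Accepted walk-ins with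
  \<open>real S + real (w i) < c\<close> cause none of them: the last one counts all the others in
  its \<open>w\<close>, so together with the show-ups they exceed \<open>c\<close> by less than 1.
  In \<open>day_regret_le\<close>, \<open>S - t\<close> is the number of show-ups that the offline
  optimum refuses as well.\<close>

lemma dass2_refused_le:
  assumes t: "t \<le> S" "real t \<le> c"
  shows "card {i. i < b \<and> shows_up \<omega> k i \<and> \<not> take1 z i}
     \<le> card {i\<in>A. c \<le> real S + real (w i)} + (S - t)" (is "card ?R \<le> card ?Bad + _")
proof (cases "?R = {}")
  case True
  then show ?thesis by (simp only: card.empty le0)
next
  case False
  obtain x where x: "c \<le> real (card {j. j < b \<and> shows_up \<omega> k j \<and> check_time \<omega> k j < x}) + real (card {j\<in>A. walk_time \<omega> k j < x})"
    and xR: "\<And>i. i < b \<Longrightarrow> shows_up \<omega> k i \<Longrightarrow> \<not> take1 z i \<Longrightarrow> x \<le> check_time \<omega> k i"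
    using first_refused[OF False] by blast
  let ?E = "{j. j < b \<and> shows_up \<omega> k j \<and> check_time \<omega> k j < x}"
  have "?R \<inter> ?E = {}"
  proof (intro equals0I)
    fix i assume "i \<in> ?R \<inter> ?E"
    then show False using xR[of i] by simp
  qed
  then have "card ?R + card ?E = card (?R \<union> ?E)"
    by (subst card_Un_disjoint) auto
  also have "\<dots> \<le> S" unfolding S_def show_ups_def by (rule card_mono) auto
  finally have RE: "card ?R + card ?E \<le> S" .
  have "card {j\<in>A. walk_time \<omega> k j < x} \<le> card A"
    using finA by (intro card_mono) auto
  with RE x have R: "real (card ?R) \<le> S + card A - c" by linarith
  define G where "G = {i\<in>A. real S + real (w i) < c}"
  have AG: "card A = card ?Bad + card G"
    unfolding G_def using finA by (subst card_Un_disjoint[symmetric]) (auto intro!: arg_cong[where f = card])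
  show ?thesis
  proof (cases "G = {}")
    case True
    have "real (card ?R) \<le> S + card ?Bad - c" using R AG True by simp
    moreover have "real (S - t) = real S - real t" using t(1) by (rule of_nat_diff)
    ultimately have "real (card ?R) \<le> real (card ?Bad) + real (S - t)" using t(2) by linarith
    then show ?thesis unfolding of_nat_add[symmetric] of_nat_le_iff .
  next
    case False
    have finG: "finite G" unfolding G_def using finA by simp
    define m where "m = Max G"
    have m: "m \<in> G" unfolding m_def using False finG by simp
    have "G \<subseteq> insert m (dass2_walk_ins P \<alpha> \<omega> k b c m)"
    proof
      fix i assume i: "i \<in> G"
      then have "i \<le> m" unfolding m_def using finG by simp
      moreover have "i \<in> A" "m < N" using i m AN by (auto simp: G_def)
      ultimately show "i \<in> insert m (dass2_walk_ins P \<alpha> \<omega> k b c m)"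
        using mem_A_below[of m i] by (cases "i = m") auto
    qed
    then have "card G \<le> card (insert m (dass2_walk_ins P \<alpha> \<omega> k b c m))"
      by (intro card_mono) auto
    also have "\<dots> \<le> w m + 1" unfolding w_def by (simp add: card_insert_if)
    \<comment> \<open>The \<open>+ 1\<close> is \<open>m\<close>, which its own \<open>w m\<close>
      does not count. The resulting strict bound by \<open>card ?Bad + 1\<close> is one between
      natural numbers, so the extra 1 vanishes.\<close>
    finally have "real S + card G < c + 1" using m unfolding G_def by auto
    with R AG have "real (card ?R) < card ?Bad + 1" by simp
    then show ?thesis by simp
  qed
qed

lemma dass2_taken_ge:
  assumes T: "T \<le> c" "T \<le> real S + real N"
  shows "T - (real (card {i. i < b \<and> shows_up \<omega> k i \<and> take1 z i}) + real (card A))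
    \<le> (\<Sum>i<N. of_bool (walk_time \<omega> k i < confirm_time P) *
        max 0 (\<alpha> * walk_mass P k (walk_time \<omega> k i) 1 - show_up_excess P \<omega> k b (walk_time \<omega> k i) - real (N - 1 - i)))"
    (is "T - (real (card ?T1) + _) \<le> (\<Sum>i<N. ?f i)")
proof -
  have sum_nonneg: "0 \<le> (\<Sum>i<N. ?f i)" by (intro sum_nonneg) auto
  show ?thesis
  proof (cases "{i. i < b \<and> shows_up \<omega> k i \<and> \<not> take1 z i} = {}")
    \<comment> \<open>A refused show-up certifies that all \<open>c\<close> rooms are taken, so
      there is no vacancy to account for.\<close>
    case False
    obtain x where x: "c \<le> real (card {j. j < b \<and> shows_up \<omega> k j \<and> check_time \<omega> k j < x}) + real (card {j\<in>A. walk_time \<omega> k j < x})"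
      and xR: "\<And>i. i < b \<Longrightarrow> shows_up \<omega> k i \<Longrightarrow> \<not> take1 z i \<Longrightarrow> x \<le> check_time \<omega> k i"
      using first_refused[OF False] by blast
    have "card {j. j < b \<and> shows_up \<omega> k j \<and> check_time \<omega> k j < x} \<le> card ?T1"
    proof (rule card_mono)
      show "{j. j < b \<and> shows_up \<omega> k j \<and> check_time \<omega> k j < x} \<subseteq> ?T1"
      proof clarify
        fix j assume "j < b" "shows_up \<omega> k j" "check_time \<omega> k j < x"
        then show "take1 z j" using xR[of j] by linarith
      qed
    qed simp
    moreover have "card {j\<in>A. walk_time \<omega> k j < x} \<le> card A"
      using finA by (intro card_mono) auto
    ultimately have "c \<le> real (card ?T1) + real (card A)" using x by linarith
    then show ?thesis using T sum_nonneg by linarith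
  next
    case True
    then have "?T1 = {i. i < b \<and> shows_up \<omega> k i}" by auto
    then have T1: "card ?T1 = S" unfolding S_def show_ups_def by simp
    define J where "J = {..<N} - A"
    show ?thesis
    proof (cases "J = {}")
      case True
      then have "A = {..<N}" using AN by (auto simp: J_def)
      then show ?thesis using T T1 sum_nonneg by simp
    next
      case False
      \<comment> \<open>\<open>m\<close> is the last rejected walk-in. The \<open>N - 1 - m\<close>
        later ones are all accepted, and the failed test at \<open>m\<close> bounds \<open>c\<close>
        from above.\<close>
      define m where "m = Max J"
      have "m \<in> J" unfolding m_def using False by (intro Max_in) (auto simp: J_def)
      then have m: "m < N" "m \<notin> A" by (auto simp: J_def)
      have after: "j \<in> A" if "m < j" "j < N" for j
      proof (rule ccontr)
        assume "j \<notin> A"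
        then have "j \<le> m" unfolding m_def using that by (intro Max_ge) (auto simp: J_def)
        then show False using that by simp
      qed
      have A_below: "A \<inter> {..<m} = dass2_walk_ins P \<alpha> \<omega> k b c m"
        using dass2_walk_ins_Int[of m N P \<alpha> \<omega> k b c] m(1) unfolding A_def N_def by simp
      have "A = (A \<inter> {..<m}) \<union> {m<..<N}"
      proof (intro set_eqI iffI)
        fix j assume "j \<in> A"
        then show "j \<in> (A \<inter> {..<m}) \<union> {m<..<N}"
          using m(2) AN by (cases j m rule: linorder_cases) auto
      qed (use after in auto)
      then have A_eq: "A = dass2_walk_ins P \<alpha> \<omega> k b c m \<union> {m<..<N}" unfolding A_below .
      have "card A = w m + (N - 1 - m)"
        unfolding w_def A_eq using dass2_walk_ins_subset[of P \<alpha> \<omega> k b c m]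
        by (subst card_Un_disjoint) auto
      have est: "c \<le> dass2_estimate P \<alpha> \<omega> k b (walk_time \<omega> k m) (w m)"
        using mem_A[OF m(1)] m(2) by simp
      show ?thesis
      proof (cases "walk_time \<omega> k m < confirm_time P")
        case True
        have "T - (real (card ?T1) + real (card A)) \<le> ?f m"
          using est T True T1 \<open>card A = w m + (N - 1 - m)\<close>
          unfolding dass2_estimate_before[OF True] S_def by simp
        \<comment> \<open>The index \<open>m\<close> depends on the policy; the sum over all
          walk-ins depends only on the arrivals and the excess.\<close>
        also have "\<dots> \<le> (\<Sum>i<N. ?f i)" using m(1) by (intro member_le_sum) auto
        finally show ?thesis .
      next
        \<comment> \<open>After the call the estimate is exact, so a rejection means that
          \<open>S + w m\<close> already reaches \<open>c\<close>.\<close>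
        case False
        then show ?thesis
          using est T T1 \<open>card A = w m + (N - 1 - m)\<close> sum_nonneg
          unfolding dass2_estimate_after[OF False] S_def by simp
      qed
    qed
  qed
qed

text \<open>After the call the estimate is \<open>S + w i\<close>, so such a walk-in would have been
  rejected. Before it, passing the test although \<open>c \<le> S + w i\<close> forces the excess
  above the safety stock.\<close>

lemma dass2_overbooked_le:
  "real (card {i\<in>A. c \<le> real S + real (w i)}) \<le>
   (\<Sum>i<N. of_bool (walk_time \<omega> k i < confirm_time P \<and>
        \<alpha> * walk_mass P k (walk_time \<omega> k i) 1 < show_up_excess P \<omega> k b (walk_time \<omega> k i)))"
proof -
  have "{i\<in>A. c \<le> real S + real (w i)} \<subseteq> {i. i < N \<and> walk_time \<omega> k i < confirm_time P \<and>
        \<alpha> * walk_mass P k (walk_time \<omega> k i) 1 < show_up_excess P \<omega> k b (walk_time \<omega> k i)}"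
  proof safe
    fix i assume i: "i \<in> A" "c \<le> real S + real (w i)"
    then show iN: "i < N" using AN by auto
    have est: "dass2_estimate P \<alpha> \<omega> k b (walk_time \<omega> k i) (w i) < c" using mem_A[OF iN] i(1) by simp
    show bef: "walk_time \<omega> k i < confirm_time P"
    proof (rule ccontr)
      assume "\<not> walk_time \<omega> k i < confirm_time P"
      from est[unfolded dass2_estimate_after[OF this]] i(2) show False unfolding S_def by simp
    qed
    show "\<alpha> * walk_mass P k (walk_time \<omega> k i) 1 < show_up_excess P \<omega> k b (walk_time \<omega> k i)"
      using est i(2) unfolding dass2_estimate_before[OF bef] S_def by simp
  qed
  then have "card {i\<in>A. c \<le> real S + real (w i)} \<le> card {i. i < N \<and> walk_time \<omega> k i < confirm_time P \<and>
        \<alpha> * walk_mass P k (walk_time \<omega> k i) 1 < show_up_excess P \<omega> k b (walk_time \<omega> k i)}"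
    by (intro card_mono) auto
  then show ?thesis unfolding of_nat_card_lessThan[symmetric] by linarith
qed

lemma dass2_taken_le:
  assumes q: "0 \<le> confirm_rate P k" and mass: "\<And>u. 0 \<le> \<alpha> * walk_mass P k u 1"
    and c: "c = real_of_int c'" "0 \<le> c"
    and sorted: "\<And>i j. i \<le> j \<Longrightarrow> j < N \<Longrightarrow> walk_time \<omega> k i \<le> walk_time \<omega> k j"
    and inj: "inj_on (check_time \<omega> k) {..<b}"
  shows "real (card {i. i < b \<and> shows_up \<omega> k i \<and> take1 z i}) + real (card A) \<le> c"
proof -
  let ?T1 = "{i. i < b \<and> shows_up \<omega> k i \<and> take1 z i}"
  have int_less: "real n \<le> c" if "real n - 1 < c" for n :: nat
  proof -
    have "real_of_int (int n - 1) < real_of_int c'" using that c by simp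
    then have "int n \<le> c'" by linarith
    then show ?thesis using c by linarith
  qed
  have last: "real (card {i. i < b \<and> shows_up \<omega> k i \<and> check_time \<omega> k i \<le> walk_time \<omega> k (Max A)}) + real (card A) - 1 < c"
    if "A \<noteq> {}"
  proof -
    define m where "m = Max A"
    have mA: "m \<in> A" unfolding m_def using that finA by simp
    then have mN: "m < N" using AN by auto
    have "A \<subseteq> insert m (dass2_walk_ins P \<alpha> \<omega> k b c m)"
    proof
      fix i assume i: "i \<in> A"
      then have "i \<le> m" unfolding m_def using finA by simp
      then show "i \<in> insert m (dass2_walk_ins P \<alpha> \<omega> k b c m)"
        using mem_A_below[OF mN i] by (cases "i = m") auto
    qed
    then have "card A \<le> card (insert m (dass2_walk_ins P \<alpha> \<omega> k b c m))" by (intro card_mono) auto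
    also have "\<dots> \<le> w m + 1" unfolding w_def by (simp add: card_insert_if)
    finally have "card A \<le> w m + 1" .
    moreover have "real (card {i. i < b \<and> shows_up \<omega> k i \<and> check_time \<omega> k i \<le> walk_time \<omega> k m}) + real (w m) < c"
      using dass2_estimate_ge_arrived[OF q mass, of b \<omega> "walk_time \<omega> k m" "w m"] mem_A[OF mN] mA by auto
    ultimately show ?thesis unfolding m_def by linarith
  qed
  show ?thesis
  proof (cases "?T1 = {}")
    case True
    show ?thesis
    proof (cases "A = {}")
      case False
      then have "real (card A) - 1 < c" using last by linarith
      then show ?thesis using int_less True by (simp del: Collect_empty_eq)
    qed (use True c in \<open>simp del: Collect_empty_eq\<close>)
  next
    case False
    define x where "x = Max (check_time \<omega> k ` ?T1)"
    have "x \<in> check_time \<omega> k ` ?T1" unfolding x_def using False by (intro Max_in) auto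
    then obtain i where i: "i \<in> ?T1" "x = check_time \<omega> k i" by auto
    have le_x: "check_time \<omega> k j \<le> x" if "j \<in> ?T1" for j
      unfolding x_def using that by (intro Max_ge) auto
    \<comment> \<open>\<open>x\<close> is the last check-in that obtains a room. If every accepted
      walk-in came strictly earlier, the Type I test at \<open>x\<close> bounds the total;
      otherwise, ties included, the test of the last accepted walk-in does.\<close>
    show ?thesis
    proof (cases "A = {} \<or> walk_time \<omega> k (Max A) < x")
      case True
      have all: "{j\<in>A. walk_time \<omega> k j < x} = A"
      proof -
        have "walk_time \<omega> k j < x" if "j \<in> A" for j
        proof -
          have "j \<le> Max A" "Max A \<in> A" using that finA by (auto intro: Max_in)
          then have "walk_time \<omega> k j \<le> walk_time \<omega> k (Max A)" using AN by (intro sorted) auto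
          then show ?thesis using True that by auto
        qed
        then show ?thesis by auto
      qed
      have "?T1 \<subseteq> insert i {j. j < b \<and> shows_up \<omega> k j \<and> check_time \<omega> k j < x}"
      proof
        fix j assume j: "j \<in> ?T1"
        show "j \<in> insert i {j. j < b \<and> shows_up \<omega> k j \<and> check_time \<omega> k j < x}"
        proof (cases "j = i")
          case False
          then have "check_time \<omega> k j \<noteq> x"
            using j i inj by (auto simp: inj_on_def)
          then show ?thesis using le_x[OF j] j by auto
        qed simp
      qed
      then have "card ?T1 \<le> card (insert i {j. j < b \<and> shows_up \<omega> k j \<and> check_time \<omega> k j < x})"
        by (intro card_mono) auto
      also have "\<dots> \<le> card {j. j < b \<and> shows_up \<omega> k j \<and> check_time \<omega> k j < x} + 1"
        by (simp add: card_insert_if)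
      finally have "real (card ?T1 + card A) - 1 < c"
        using i all by (auto simp: take1_eq)
      then show ?thesis using int_less by fastforce
    next
      case False
      have "card ?T1 \<le> card {i. i < b \<and> shows_up \<omega> k i \<and> check_time \<omega> k i \<le> walk_time \<omega> k (Max A)}"
      proof (rule card_mono)
        have "x \<le> walk_time \<omega> k (Max A)" using False by simp
        then show "?T1 \<subseteq> {i. i < b \<and> shows_up \<omega> k i \<and> check_time \<omega> k i \<le> walk_time \<omega> k (Max A)}"
          using le_x order_trans by blast
      qed simp
      then have "real (card ?T1 + card A) - 1 < c" using last False by fastforce
      then show ?thesis using int_less by fastforce
    qed
  qed
qed

end

section \<open>The loss of a single day and the offline optimum\<close>

definition prior_occupancy :: "stage2 \<Rightarrow> (nat \<Rightarrow> nat) \<Rightarrow> (nat \<Rightarrow> decision) \<Rightarrow> nat \<Rightarrow> nat" where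
  "prior_occupancy \<omega> B z k = (\<Sum>k'=1..<k. occupants \<omega> B z k k')"

definition served1 :: "stage2 \<Rightarrow> nat \<Rightarrow> nat \<Rightarrow> decision \<Rightarrow> nat" where
  "served1 \<omega> k b z = card {i. i < b \<and> shows_up \<omega> k i \<and> take1 z i}"

definition refused1 :: "stage2 \<Rightarrow> nat \<Rightarrow> nat \<Rightarrow> decision \<Rightarrow> nat" where
  "refused1 \<omega> k b z = card {i. i < b \<and> shows_up \<omega> k i \<and> \<not> take1 z i}"

definition served2 :: "stage2 \<Rightarrow> nat \<Rightarrow> decision \<Rightarrow> nat" where
  "served2 \<omega> k z = card {i. i < walk_num \<omega> k \<and> take2 z i}"

text \<open>The day-\<open>k\<close> loss with the history separated from the day-\<open>k\<close>
  decision. No stay lengths occur for day \<open>k\<close> itself, since \<open>k - k = 0\<close> is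
  below every stay.\<close>

definition day_loss :: "params \<Rightarrow> stage2 \<Rightarrow> (nat \<Rightarrow> nat) \<Rightarrow> (nat \<Rightarrow> decision) \<Rightarrow> nat \<Rightarrow> decision \<Rightarrow> real" where
  "day_loss P \<omega> B h k z = over_loss P k * real (refused1 \<omega> k (B k) z) +
     revenue P k * (real (capacity P) - real (prior_occupancy \<omega> B h k)
       - real (served1 \<omega> k (B k) z) - real (served2 \<omega> k z))"

lemma occupants_upd: "k' \<noteq> k \<Longrightarrow> occupants \<omega> B (h(k := z)) l k' = occupants \<omega> B h l k'"
  unfolding occupants_def by simp

lemma prior_occupancy_upd: "prior_occupancy \<omega> B (h(k := z)) k = prior_occupancy \<omega> B h k"
  unfolding prior_occupancy_def by (intro sum.cong refl occupants_upd) auto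

lemma room_capacity_upd: "room_capacity P \<omega> B (h(k := z)) k = room_capacity P \<omega> B h k"
proof -
  have "(\<Sum>k'=1..<k. real (occupants \<omega> B (h(k := z)) k k')) = (\<Sum>k'=1..<k. real (occupants \<omega> B h k k'))"
    by (intro sum.cong refl arg_cong[where f = real] occupants_upd) auto
  then show ?thesis unfolding room_capacity_def by (simp only:)
qed

lemma loss_upd:
  assumes "1 \<le> k"
  shows "loss P \<omega> B (h(k := z)) k = day_loss P \<omega> B h k z"
proof -
  have "{1..k} = insert k {1..<k}" using assms by auto
  then have "occupancy \<omega> B (h(k := z)) k = occupants \<omega> B (h(k := z)) k k + prior_occupancy \<omega> B (h(k := z)) k"
    unfolding occupancy_def prior_occupancy_def by simp
  moreover have "occupants \<omega> B (h(k := z)) k k = served1 \<omega> k (B k) z + served2 \<omega> k z"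
    unfolding occupants_def served1_def served2_def by simp
  ultimately show ?thesis
    unfolding loss_def day_loss_def refused1_def prior_occupancy_upd by (simp add: algebra_simps)
qed

lemma day_feasible_upd:
  "day_feasible P \<omega> B (h(k := z)) k \<longleftrightarrow>
     real (served1 \<omega> k (B k) z) + real (served2 \<omega> k z) \<le> room_capacity P \<omega> B h k"
  unfolding day_feasible_def room_capacity_upd served1_def served2_def by simp

lemma served1_plus_refused1:
  "served1 \<omega> k b z + refused1 \<omega> k b z = show_ups \<omega> k b"
proof -
  have "{i. i < b \<and> shows_up \<omega> k i} =
     {i. i < b \<and> shows_up \<omega> k i \<and> take1 z i} \<union> {i. i < b \<and> shows_up \<omega> k i \<and> \<not> take1 z i}"
    by auto
  also have "card \<dots> = served1 \<omega> k b z + refused1 \<omega> k b z"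
    unfolding served1_def refused1_def by (rule card_Un_disjoint) auto
  finally show ?thesis unfolding show_ups_def by (rule sym)
qed

lemma served2_le: "served2 \<omega> k z \<le> walk_num \<omega> k"
  unfolding served2_def by (rule card_lessThan_Collect_le)

text \<open>
  With a negative room capacity no decision is feasible and \<open>arg_min\<close> returns a fixed junk decision. This
  happens only on a null set, but integrability still needs measurability there.
\<close>

lemma loss_offline_opt_infeasible:
  assumes "1 \<le> k" "room_capacity P \<omega> B h k < 0"
  shows "loss P \<omega> B (offline_opt P \<omega> B h k) k = day_loss P \<omega> B h k (SOME z. False)"
proof -
  have "\<not> day_feasible P \<omega> B (h(k := z)) k" for z
    unfolding day_feasible_upd using assms(2) by (simp add: not_le add_nonneg_nonneg order.strict_trans2)
  then show ?thesis
    unfolding offline_opt_def loss_upd[OF assms(1)] arg_min_def is_arg_min_def by simp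
qed

text \<open>Serving show-ups first and filling up with walk-ins maximizes the number of served
  show-ups and the total served simultaneously. The loss is nonincreasing in both, so overbooking
  and revenue are never traded against each other.\<close>

lemma loss_offline_opt_feasible:
  assumes k: "1 \<le> k" and c: "0 \<le> room_capacity P \<omega> B h k"
    and nonneg: "0 \<le> over_loss P k" "0 \<le> revenue P k"
  defines "S \<equiv> show_ups \<omega> k (B k)" and "N \<equiv> walk_num \<omega> k"
    and "m \<equiv> nat \<lfloor>room_capacity P \<omega> B h k\<rfloor>"
  shows "loss P \<omega> B (offline_opt P \<omega> B h k) k =
    over_loss P k * (real S - real (min S m)) +
    revenue P k * (real (capacity P) - real (prior_occupancy \<omega> B h k) - real (min (S + N) m))"
proof -
  have m_iff: "real n \<le> room_capacity P \<omega> B h k \<longleftrightarrow> n \<le> m" for n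
    unfolding m_def using c by (simp add: le_nat_iff le_floor_iff)
  have feas: "day_feasible P \<omega> B (h(k := z)) k \<longleftrightarrow> served1 \<omega> k (B k) z + served2 \<omega> k z \<le> m" for z
    unfolding day_feasible_upd m_iff[symmetric] by simp
  have refused: "real (refused1 \<omega> k (B k) z) = real S - real (served1 \<omega> k (B k) z)" for z
    using served1_plus_refused1[of \<omega> k "B k" z] unfolding S_def by linarith
  obtain T where T: "T \<subseteq> {i. i < B k \<and> shows_up \<omega> k i}" "card T = min S m"
    unfolding S_def show_ups_def by (meson min.cobounded1 obtain_subset_with_card_n)
  define z0 where "z0 = \<lparr>take1 = (\<lambda>i. i \<in> T), take2 = (\<lambda>i. i < m - min S m)\<rparr>"
  have "{i. i < B k \<and> shows_up \<omega> k i \<and> take1 z0 i} = T" using T(1) by (auto simp: z0_def)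
  then have s1: "served1 \<omega> k (B k) z0 = min S m" unfolding served1_def using T(2) by simp
  have "{i. i < N \<and> take2 z0 i} = {..<min N (m - min S m)}" by (auto simp: z0_def)
  then have s2: "served2 \<omega> k z0 = min N (m - min S m)" unfolding served2_def N_def[symmetric] by simp
  have tot: "min S m + min N (m - min S m) = min (S + N) m" by auto
  have "day_loss P \<omega> B h k (arg_min (\<lambda>z. day_loss P \<omega> B h k z) (\<lambda>z. day_feasible P \<omega> B (h(k := z)) k))
    = day_loss P \<omega> B h k z0"
  proof (rule arg_min_equality)
    show "day_feasible P \<omega> B (h(k := z0)) k" unfolding feas s1 s2 by simp
  next
    fix z assume "day_feasible P \<omega> B (h(k := z)) k"
    then have z: "served1 \<omega> k (B k) z + served2 \<omega> k z \<le> m" unfolding feas .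
    have z1: "served1 \<omega> k (B k) z \<le> S"
      using served1_plus_refused1[of \<omega> k "B k" z] unfolding S_def by linarith
    have z2: "served2 \<omega> k z \<le> N" unfolding N_def by (rule served2_le)
    have "served1 \<omega> k (B k) z \<le> served1 \<omega> k (B k) z0" unfolding s1 using z z1 by simp
    moreover have "served1 \<omega> k (B k) z + served2 \<omega> k z \<le> served1 \<omega> k (B k) z0 + served2 \<omega> k z0"
      unfolding s1 s2 tot using z z1 z2 by simp
    then have "real (served1 \<omega> k (B k) z) + real (served2 \<omega> k z) \<le> real (served1 \<omega> k (B k) z0) + real (served2 \<omega> k z0)"
      unfolding of_nat_add[symmetric] of_nat_le_iff .
    ultimately show "day_loss P \<omega> B h k z0 \<le> day_loss P \<omega> B h k z"
      unfolding day_loss_def refused using nonneg by (intro add_mono mult_left_mono) auto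
  qed
  then have "loss P \<omega> B (offline_opt P \<omega> B h k) k = day_loss P \<omega> B h k z0"
    unfolding offline_opt_def loss_upd[OF k] .
  also have "\<dots> = over_loss P k * (real S - real (min S m)) +
    revenue P k * (real (capacity P) - real (prior_occupancy \<omega> B h k) - real (min S m + min N (m - min S m)))"
    unfolding day_loss_def refused s1 s2 of_nat_add by (simp only: diff_diff_add add.assoc)
  finally show ?thesis unfolding tot .
qed

text \<open>For integrability: the occupancy from earlier days cancels, which leaves a bound linear
  in the number of walk-ins.\<close>

lemma abs_day_loss_diff_le:
  assumes nonneg: "0 \<le> over_loss P k" "0 \<le> revenue P k"
  shows "\<bar>day_loss P \<omega> B h k z - day_loss P \<omega> B h k z'\<bar>
    \<le> (over_loss P k + revenue P k) * (real (B k) + real (walk_num \<omega> k))"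
proof -
  have b: "served1 \<omega> k (B k) z + refused1 \<omega> k (B k) z \<le> B k" for z
    unfolding served1_plus_refused1 show_ups_def by (rule card_lessThan_Collect_le)
  define u u' t t' where "u = real (refused1 \<omega> k (B k) z)" and "u' = real (refused1 \<omega> k (B k) z')"
    and "t = real (served1 \<omega> k (B k) z) + real (served2 \<omega> k z)"
    and "t' = real (served1 \<omega> k (B k) z') + real (served2 \<omega> k z')"
  have "\<bar>u - u'\<bar> \<le> real (B k) + real (walk_num \<omega> k)"
    using b[of z] b[of z'] unfolding u_def u'_def by linarith
  moreover have "\<bar>t' - t\<bar> \<le> real (B k) + real (walk_num \<omega> k)"
    using b[of z] b[of z'] served2_le[of \<omega> k z] served2_le[of \<omega> k z'] unfolding t_def t'_def by linarith
  ultimately have "\<bar>over_loss P k * (u - u')\<bar> + \<bar>revenue P k * (t' - t)\<bar>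
    \<le> (over_loss P k + revenue P k) * (real (B k) + real (walk_num \<omega> k))"
    unfolding abs_mult distrib_right using nonneg by (intro add_mono mult_mono) auto
  moreover have "day_loss P \<omega> B h k z - day_loss P \<omega> B h k z' = over_loss P k * (u - u') + revenue P k * (t' - t)"
    unfolding day_loss_def u_def u'_def t_def t'_def by (simp add: algebra_simps)
  ultimately show ?thesis by linarith
qed

text \<open>The history handed to \<open>offline_opt\<close> in the theorem already contains the
  decision of DASS-II for day \<open>k\<close>; it is overwritten.\<close>

lemma offline_opt_upd: "offline_opt P \<omega> B (h(k := z)) k = offline_opt P \<omega> B h k"
  unfolding offline_opt_def by simp

lemma day_regret_le:
  fixes \<alpha> :: real
  assumes k: "1 \<le> k" and c: "0 \<le> room_capacity P \<omega> B h k"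
    and nonneg: "0 \<le> over_loss P k" "0 \<le> revenue P k"
  defines "z \<equiv> dass2_day P \<alpha> \<omega> k (B k) (room_capacity P \<omega> B h k)"
    and "D \<equiv> \<lambda>i. show_up_excess P \<omega> k (B k) (walk_time \<omega> k i)"
    and "m \<equiv> \<lambda>i. \<alpha> * walk_mass P k (walk_time \<omega> k i) 1"
  shows "day_loss P \<omega> B h k z - loss P \<omega> B (offline_opt P \<omega> B h k) k \<le>
    over_loss P k * (\<Sum>i<walk_num \<omega> k. of_bool (walk_time \<omega> k i < confirm_time P \<and> m i < D i)) +
    revenue P k * (\<Sum>i<walk_num \<omega> k. of_bool (walk_time \<omega> k i < confirm_time P) *
        max 0 (m i - D i - real (walk_num \<omega> k - 1 - i)))"
proof -
  let ?c = "room_capacity P \<omega> B h k" and ?N = "walk_num \<omega> k"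
  define S where "S = show_ups \<omega> k (B k)"
  \<comment> \<open>\<open>t\<close> and \<open>T\<close> are the numbers of show-ups and of all
    customers that the offline optimum serves.\<close>
  define t where "t = min S (nat \<lfloor>?c\<rfloor>)"
  define T where "T = min (S + ?N) (nat \<lfloor>?c\<rfloor>)"
  have fl: "real (nat \<lfloor>?c\<rfloor>) \<le> ?c" using c by simp
  have t: "t \<le> S" "real t \<le> ?c" unfolding t_def using fl by (auto simp: min_def)
  have T: "real T \<le> ?c" "real T \<le> real S + real ?N" unfolding T_def using fl by (auto simp: min_def)
  have opt: "loss P \<omega> B (offline_opt P \<omega> B h k) k =
    over_loss P k * (real S - real t) +
    revenue P k * (real (capacity P) - real (prior_occupancy \<omega> B h k) - real T)"
    unfolding loss_offline_opt_feasible[OF k c nonneg] S_def t_def T_def ..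
  have "refused1 \<omega> k (B k) z \<le> card {i\<in>dass2_walk_ins P \<alpha> \<omega> k (B k) ?c ?N.
      ?c \<le> real S + real (card (dass2_walk_ins P \<alpha> \<omega> k (B k) ?c i))} + (S - t)"
    unfolding refused1_def z_def using t unfolding S_def by (rule dass2_refused_le)
  moreover have "real (S - t) = real S - real t" using t(1) by (rule of_nat_diff)
  moreover note dass2_overbooked_le[where P = P and \<alpha> = \<alpha> and \<omega> = \<omega> and k = k and b = "B k" and c = ?c]
  ultimately have over: "real (refused1 \<omega> k (B k) z) - (real S - real t) \<le>
    (\<Sum>i<?N. of_bool (walk_time \<omega> k i < confirm_time P \<and> m i < D i))"
    unfolding S_def m_def D_def by linarith
  have rev: "real T - (real (served1 \<omega> k (B k) z) + real (served2 \<omega> k z)) \<le>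
    (\<Sum>i<?N. of_bool (walk_time \<omega> k i < confirm_time P) * max 0 (m i - D i - real (?N - 1 - i)))"
    unfolding served1_def served2_def z_def m_def D_def dass2_taken2
    using T unfolding S_def by (rule dass2_taken_ge)
  have "day_loss P \<omega> B h k z - loss P \<omega> B (offline_opt P \<omega> B h k) k =
    over_loss P k * (real (refused1 \<omega> k (B k) z) - (real S - real t)) +
    revenue P k * (real T - (real (served1 \<omega> k (B k) z) + real (served2 \<omega> k z)))"
    unfolding opt day_loss_def by (simp add: algebra_simps)
  also have "\<dots> \<le> over_loss P k * (\<Sum>i<?N. of_bool (walk_time \<omega> k i < confirm_time P \<and> m i < D i)) +
    revenue P k * (\<Sum>i<?N. of_bool (walk_time \<omega> k i < confirm_time P) * max 0 (m i - D i - real (?N - 1 - i)))"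
    by (intro add_mono mult_left_mono over rev nonneg)
  finally show ?thesis .
qed

section \<open>Poisson arrivals and exponential moments\<close>

lemma exp_le_quadratic:
  fixes x :: real
  assumes "\<bar>x\<bar> \<le> 1"
  shows "exp x \<le> 1 + x + x\<^sup>2"
proof (cases "0 \<le> x")
  case True
  then show ?thesis using assms by (intro exp_bound) auto
next
  case False
  define y where "y = - x"
  have y: "0 \<le> y" using False by (simp add: y_def)
  \<comment> \<open>The product equals 1 + y^3.\<close>
  have "1 \<le> (1 - y + y\<^sup>2) * (1 + y)"
    using y by (simp add: algebra_simps power2_eq_square)
  also have "\<dots> \<le> (1 - y + y\<^sup>2) * exp y"
  proof (rule mult_left_mono[OF exp_ge_add_one_self])
    have "0 \<le> (1 - y / 2)\<^sup>2 + 3 / 4 * y\<^sup>2" by simp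
    also have "\<dots> = 1 - y + y\<^sup>2" by (simp add: power2_eq_square algebra_simps)
    finally show "0 \<le> 1 - y + y\<^sup>2" .
  qed
  finally have "exp (- y) * 1 \<le> exp (- y) * ((1 - y + y\<^sup>2) * exp y)"
    by (intro mult_left_mono) auto
  also have "\<dots> = 1 - y + y\<^sup>2" by (simp add: exp_minus)
  finally show ?thesis by (simp add: y_def)
qed

text \<open>Centering cancels the linear terms of the quadratic bound, and the quadratic ones add up
  to the variance. A bound through the variance, rather than through the range of the variable, is
  what \<open>show_up_variance\<close> can control.\<close>

lemma bernoulli_centered_mgf_le:
  fixes q \<theta> :: real
  assumes q: "0 \<le> q" "q \<le> 1" and \<theta>: "\<bar>\<theta>\<bar> \<le> 1"
  shows "q * exp (\<theta> * (1 - q)) + (1 - q) * exp (- \<theta> * q) \<le> exp (\<theta>\<^sup>2 * (q * (1 - q)))"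
proof -
  have 1: "\<bar>\<theta> * (1 - q)\<bar> \<le> 1" "\<bar>- \<theta> * q\<bar> \<le> 1"
    using q \<theta> by (auto simp: abs_mult intro!: mult_le_one)
  have "q * exp (\<theta> * (1 - q)) + (1 - q) * exp (- \<theta> * q)
     \<le> q * (1 + \<theta> * (1 - q) + (\<theta> * (1 - q))\<^sup>2) + (1 - q) * (1 + (- \<theta> * q) + (- \<theta> * q)\<^sup>2)"
    using q 1 by (intro add_mono mult_left_mono exp_le_quadratic) auto
  also have "\<dots> = 1 + \<theta>\<^sup>2 * (q * (1 - q))" by (simp add: power2_eq_square algebra_simps)
  also have "\<dots> \<le> exp (\<theta>\<^sup>2 * (q * (1 - q)))" by (rule exp_ge_add_one_self)
  finally show ?thesis .
qed

text \<open>
  Fubini for independent sub-\<open>\<sigma>\<close>-algebras: the identity map, read with \<open>F\<close> and with \<open>G\<close> as target, is a pair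
  of independent random variables.
\<close>

lemma (in prob_space) nn_integral_decouple:
  assumes ind: "indep_set (sets F) (sets G)" and sp: "space F = space M" "space G = space M"
    and f [measurable]: "f \<in> borel_measurable (F \<Otimes>\<^sub>M G)"
  shows "(\<integral>\<^sup>+x. f (x, x) \<partial>M) = (\<integral>\<^sup>+x. \<integral>\<^sup>+y. f (x, y) \<partial>M \<partial>M)"
proof -
  have sub: "sets F \<subseteq> sets M" "sets G \<subseteq> sets M"
    using indep_setD_ev1[OF ind] indep_setD_ev2[OF ind] by auto
  have idF [measurable]: "(\<lambda>x. x) \<in> measurable M F" and idG [measurable]: "(\<lambda>x. x) \<in> measurable M G"
    using sub sp by (auto intro!: measurableI simp: subset_eq Int_absorb2 sets.sets_into_space)
  have gen: "sigma_sets (space M) {(\<lambda>x. x) -` A \<inter> space M |A. A \<in> sets H} = sets H"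
    if "space H = space M" for H :: "'a measure"
  proof -
    have "{(\<lambda>x. x) -` A \<inter> space M |A. A \<in> sets H} = sets H"
    proof (intro equalityI subsetI)
      fix B assume "B \<in> {(\<lambda>x. x) -` A \<inter> space M |A. A \<in> sets H}"
      then obtain A where A: "A \<in> sets H" "B = A \<inter> space M" by auto
      then show "B \<in> sets H" using sets.sets_into_space[OF A(1)] that by (simp add: Int_absorb2)
    next
      fix B assume B: "B \<in> sets H"
      then have "B = (\<lambda>x. x) -` B \<inter> space M" using sets.sets_into_space[OF B] that by auto
      with B show "B \<in> {(\<lambda>x. x) -` A \<inter> space M |A. A \<in> sets H}" by blast
    qed
    then show ?thesis using sets.sigma_sets_eq[of H] that by simp
  qed
  have "indep_var F (\<lambda>x. x) G (\<lambda>x. x)"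
    unfolding indep_var_eq gen[OF sp(1)] gen[OF sp(2)] using ind idF idG by blast
  then have joint: "distr M F (\<lambda>x. x) \<Otimes>\<^sub>M distr M G (\<lambda>x. x) = distr M (F \<Otimes>\<^sub>M G) (\<lambda>x. (x, x))"
    unfolding indep_var_distribution_eq by blast
  interpret G: prob_space "distr M G (\<lambda>x. x)" by (rule prob_space_distr) fact
  have "(\<integral>\<^sup>+x. f (x, x) \<partial>M) = (\<integral>\<^sup>+p. f p \<partial>distr M (F \<Otimes>\<^sub>M G) (\<lambda>x. (x, x)))"
    by (subst nn_integral_distr) auto
  also have "\<dots> = (\<integral>\<^sup>+x. \<integral>\<^sup>+y. f (x, y) \<partial>distr M G (\<lambda>x. x) \<partial>distr M F (\<lambda>x. x))"
    unfolding joint[symmetric] by (rule G.nn_integral_fst[symmetric]) simp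
  also have "\<dots> = (\<integral>\<^sup>+x. \<integral>\<^sup>+y. f (x, y) \<partial>distr M G (\<lambda>x. x) \<partial>M)"
    by (rule nn_integral_distr) measurable
  also have "\<dots> = (\<integral>\<^sup>+x. \<integral>\<^sup>+y. f (x, y) \<partial>M \<partial>M)"
    by (intro nn_integral_cong nn_integral_distr) (auto simp: sp)
  finally show ?thesis .
qed

section \<open>Mass of an integrable rate over intervals\<close>

context
  fixes f :: "real \<Rightarrow> real"
  assumes nonneg: "\<And>u. 0 \<le> f u" and integrable: "integrable lborel f"
begin

private lemma set_int: "A \<in> sets lborel \<Longrightarrow> set_integrable lborel A f"
  unfolding set_integrable_def using integrable by (intro integrable_mult_indicator)

private lemma set_int_Icc: "set_integrable lborel {a..b} f" for a b :: real
  by (rule set_int) simp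

lemma LBINT_Icc_nonneg: "0 \<le> (LBINT u:{a..b}. f u)"
  unfolding set_lebesgue_integral_def by (intro integral_nonneg_AE) (auto simp: nonneg)

lemma LBINT_Icc_add:
  fixes a b c :: real
  assumes "a \<le> b" "b \<le> c"
  shows "(LBINT u:{a..c}. f u) = (LBINT u:{a..b}. f u) + (LBINT u:{b..c}. f u)"
proof -
  have "interval_lebesgue_integrable lborel (ereal a) (ereal c) f"
    unfolding interval_lebesgue_integrable_def using assms by (simp add: set_int)
  then have "(LBINT u=a..b. f u) + (LBINT u=b..c. f u) = (LBINT u=a..c. f u)"
    using assms by (intro interval_integral_sum) (simp add: min_def max_def)
  then show ?thesis using assms by (simp add: interval_integral_Icc)
qed

lemma LBINT_Icc_antimono:
  fixes u v b :: real
  assumes "u \<le> v"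
  shows "(LBINT x:{v..b}. f x) \<le> (LBINT x:{u..b}. f x)"
  unfolding set_lebesgue_integral_def
  using assms set_int_Icc[unfolded set_integrable_def]
  by (intro integral_mono) (auto simp: nonneg indicator_def)

text \<open>Monotone functions are Borel; the sign turns the decreasing mass into an increasing
  function.\<close>

lemma borel_measurable_LBINT_Icc [measurable]: "(\<lambda>u. LBINT x:{u..b}. f x) \<in> borel_measurable borel"
proof -
  have "(\<lambda>u. - (LBINT x:{u..b}. f x)) \<in> borel_measurable borel"
    by (intro borel_measurable_mono monoI le_imp_neg_le LBINT_Icc_antimono)
  then show ?thesis by simp
qed

lemma LBINT_Icc_sum_partition:
  fixes v :: real and m n :: nat
  assumes "0 \<le> v"
  shows "(\<Sum>j<n. LBINT u:{v * j / m .. v * Suc j / m}. f u) = (LBINT u:{0..v * n / m}. f u)"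
proof (induction n)
  case 0
  \<comment> \<open>Additivity at the degenerate interval reads x = x + x.\<close>
  have "(LBINT u:{0..0}. f u) = 0"
    using LBINT_Icc_add[of 0 0 0] by simp
  then show ?case by simp
next
  case (Suc n)
  have "0 \<le> v * real n / real m" "v * real n / real m \<le> v * real (Suc n) / real m"
    using assms by (simp_all add: divide_right_mono mult_left_mono)
  from LBINT_Icc_add[OF this] Suc show ?case unfolding sum.lessThan_Suc by linarith
qed

text \<open>The rate is only integrable and may be unbounded, so the length of the pieces comes from
  uniform continuity of the indefinite integral.\<close>

lemma LBINT_Icc_fine_partition:
  fixes v :: real
  assumes "0 \<le> v"
  obtains n :: nat where "0 < n" "\<And>j. j < n \<Longrightarrow> (LBINT u:{v * j / n .. v * Suc j / n}. f u) \<le> 1"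
proof -
  define F where "F t = (LBINT u:{0..t}. f u)" for t
  have "continuous_on {0..v} (\<lambda>t. integral {0..t} f)"
    by (rule indefinite_integral_continuous_1) (rule set_borel_integral_eq_integral(1)[OF set_int_Icc])
  then have "continuous_on {0..v} F"
    unfolding F_def set_borel_integral_eq_integral(2)[OF set_int_Icc] .
  then have "uniformly_continuous_on {0..v} F"
    by (rule compact_uniformly_continuous) simp
  then obtain d where d: "d > 0" "\<And>x y. x \<in> {0..v} \<Longrightarrow> y \<in> {0..v} \<Longrightarrow> dist y x < d \<Longrightarrow> dist (F y) (F x) < 1"
    unfolding uniformly_continuous_on_def by (metis zero_less_one)
  obtain n where n: "v / d < real n" using reals_Archimedean2 by blast
  have "0 \<le> v / d" using assms d(1) by simp
  with n have n0: "0 < n" by (cases n) auto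
  have vn: "v / n < d" using n n0 d(1) by (simp add: field_simps)
  show ?thesis
  proof (rule that[OF n0])
    fix j assume j: "j < n"
    have le: "0 \<le> v * j / n" "v * j / n \<le> v * Suc j / n"
      using assms by (simp_all add: divide_right_mono mult_left_mono)
    have "v * Suc j \<le> v * n" using assms j by (intro mult_left_mono) auto
    then have le3: "v * Suc j / n \<le> v" using n0 by (simp add: field_simps)
    have "v * Suc j / n - v * j / n = v / n" by (simp add: field_simps add_divide_distrib)
    then have "dist (v * Suc j / n) (v * j / n) < d"
      using le(2) vn by (simp add: dist_real_def)
    then have "dist (F (v * Suc j / n)) (F (v * j / n)) < 1"
      using le le3 by (intro d(2)) auto
    then show "(LBINT u:{v * j / n .. v * Suc j / n}. f u) \<le> 1"
      using LBINT_Icc_add[OF le(1,2)] unfolding F_def dist_real_def by linarith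
  qed
qed

end

section \<open>Expectations of functions of Poisson counts\<close>

lemma poisson_mean_sums: "(\<lambda>n. real n * (m ^ n / fact n * exp (- m))) sums (m::real)"
proof -
  have "(\<lambda>n. m * exp (- m) * (m ^ n /\<^sub>R fact n)) sums (m * exp (- m) * exp m)"
    by (intro sums_mult exp_converges)
  moreover have "m * exp (- m) * (m ^ n /\<^sub>R fact n) = real (Suc n) * (m ^ Suc n / fact (Suc n) * exp (- m))" for n
    by (simp add: fact_Suc divide_inverse_commute del: of_nat_Suc)
  moreover have "m * exp (- m) * exp m = m" by (simp add: exp_minus)
  ultimately have "(\<lambda>n. real (Suc n) * (m ^ Suc n / fact (Suc n) * exp (- m))) sums m"
    by (simp only:)
  then show ?thesis by (subst (asm) sums_Suc_iff) simp
qed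

text \<open>The Laplace transform of a Poisson count. Its rate \<open>1 - exp (- s)\<close> later
  competes with \<open>s * \<alpha>\<close>.\<close>

lemma poisson_mgf_sums:
  "(\<lambda>n. exp (- s * real n) * (m ^ n / fact n * exp (- m))) sums exp (- (1 - exp (- s)) * (m::real))"
proof -
  have "(\<lambda>n. exp (- m) * ((exp (- s) * m) ^ n /\<^sub>R fact n)) sums (exp (- m) * exp (exp (- s) * m))"
    by (intro sums_mult exp_converges)
  moreover have "exp (- m) * ((exp (- s) * m) ^ n /\<^sub>R fact n) = exp (- s * real n) * (m ^ n / fact n * exp (- m))" for n
    by (simp add: power_mult_distrib exp_of_nat_mult[symmetric] field_simps)
  moreover have "exp (- m) * exp (exp (- s) * m) = exp (- (1 - exp (- s)) * m)"
    by (simp add: exp_add[symmetric] algebra_simps)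
  ultimately show ?thesis by simp
qed

text \<open>Summation over the level sets of \<open>N\<close>. The explicit probabilities include
  mass 0, where \<open>0 ^ 0 = 1\<close> puts all weight on the value 0.\<close>

lemma (in prob_space) nn_integral_poisson:
  fixes N :: "'a \<Rightarrow> nat" and g :: "nat \<Rightarrow> real"
  assumes N [measurable]: "N \<in> measurable M (count_space UNIV)"
    and law: "\<And>n. prob {\<omega> \<in> space M. N \<omega> = n} = m ^ n / fact n * exp (- m)"
    and m: "0 \<le> m" and g: "\<And>n. 0 \<le> g n" and sums: "(\<lambda>n. g n * (m ^ n / fact n * exp (- m))) sums x"
  shows "(\<integral>\<^sup>+\<omega>. g (N \<omega>) \<partial>M) = ennreal x"
proof -
  define A where "A n = {\<omega> \<in> space M. N \<omega> = n}" for n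
  have A [measurable]: "A n \<in> sets M" for n unfolding A_def by measurable
  have "(\<integral>\<^sup>+\<omega>. g (N \<omega>) \<partial>M) = (\<integral>\<^sup>+\<omega>. (\<Sum>n. ennreal (g n) * indicator (A n) \<omega>) \<partial>M)"
  proof (intro nn_integral_cong)
    fix \<omega> assume "\<omega> \<in> space M"
    then have "\<omega> \<in> A (N \<omega>)" by (simp add: A_def)
    moreover have "disjoint_family A" by (auto simp: disjoint_family_on_def A_def)
    ultimately show "ennreal (g (N \<omega>)) = (\<Sum>n. ennreal (g n) * indicator (A n) \<omega>)"
      by (intro suminf_cmult_indicator[symmetric])
  qed
  also have "\<dots> = (\<Sum>n. \<integral>\<^sup>+\<omega>. ennreal (g n) * indicator (A n) \<omega> \<partial>M)"
    by (intro nn_integral_suminf) measurable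
  also have "\<dots> = (\<Sum>n. ennreal (g n * (m ^ n / fact n * exp (- m))))"
  proof (intro suminf_cong)
    fix n
    have "(\<integral>\<^sup>+\<omega>. ennreal (g n) * indicator (A n) \<omega> \<partial>M) = ennreal (g n) * emeasure M (A n)"
      by (simp add: nn_integral_cmult)
    also have "\<dots> = ennreal (g n * (m ^ n / fact n * exp (- m)))"
      using law[of n] g[of n] m unfolding A_def by (simp add: emeasure_eq_measure ennreal_mult'[symmetric])
    finally show "(\<integral>\<^sup>+\<omega>. ennreal (g n) * indicator (A n) \<omega> \<partial>M) = ennreal (g n * (m ^ n / fact n * exp (- m)))" .
  qed
  also have "\<dots> = ennreal x"
    using g m by (intro suminf_ennreal_eq sums) auto
  finally show ?thesis .
qed

lemma measurable_arrivals_in: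
  assumes [measurable]: "N \<in> measurable M (count_space UNIV)" "\<And>i. X i \<in> borel_measurable M"
  shows "arrivals_in N X s t \<in> measurable M (count_space UNIV)"
proof -
  have "(\<lambda>\<omega>. card {i. i < N \<omega> \<and> s < X i \<omega> \<and> X i \<omega> \<le> t}) \<in> measurable M (count_space UNIV)"
    by measurable
  then show ?thesis unfolding arrivals_in_def[abs_def] .
qed


text \<open>\<open>a\<close> marks the reservations still open once the check-in times are frozen.
  Each closed one gives a factor 1, which is below the variance factor, so the bound is the same for
  every \<open>a\<close> and hence for every time at which the excess is read.\<close>

lemma (in prob_space) nn_integral_exp_bernoulli_sum_le:
  fixes Y :: "nat \<Rightarrow> 'a \<Rightarrow> bool" and a :: "nat \<Rightarrow> bool"
  assumes ind: "indep_vars (\<lambda>_. count_space UNIV) Y {..<b}"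
    and law: "\<And>j. j < b \<Longrightarrow> distr M (count_space UNIV) (Y j) = measure_pmf (bernoulli_pmf q)"
    and q: "0 \<le> q" "q \<le> 1" and \<theta>: "\<bar>\<theta>\<bar> \<le> 1"
  shows "(\<integral>\<^sup>+\<omega>. ennreal (exp (\<theta> * (\<Sum>j<b. of_bool (a j) * (of_bool (Y j \<omega>) - q)))) \<partial>M)
    \<le> ennreal (exp (\<theta>\<^sup>2 * (q * (1 - q) * real b)))"
proof -
  define g where "g j y = ennreal (exp (\<theta> * (of_bool (a j) * (of_bool y - q))))" for j y
  have rv: "Y j \<in> measurable M (count_space UNIV)" if "j < b" for j
    using ind that unfolding indep_vars_def by auto
  have "indep_vars (\<lambda>_. borel) (\<lambda>j \<omega>. g j (Y j \<omega>)) {..<b}"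
    by (rule indep_vars_compose2[OF ind]) simp
  then have "(\<integral>\<^sup>+\<omega>. (\<Prod>j<b. g j (Y j \<omega>)) \<partial>M) = (\<Prod>j<b. \<integral>\<^sup>+\<omega>. g j (Y j \<omega>) \<partial>M)"
    by (intro indep_vars_nn_integral) auto
  also have "\<dots> \<le> (\<Prod>j<b. ennreal (exp (\<theta>\<^sup>2 * (q * (1 - q)))))"
  proof (rule prod_mono_ennreal)
    fix j assume "j \<in> {..<b}"
    then have j: "j < b" by simp
    have "(\<integral>\<^sup>+\<omega>. g j (Y j \<omega>) \<partial>M) = (\<integral>\<^sup>+y. g j y \<partial>distr M (count_space UNIV) (Y j))"
      by (rule nn_integral_distr[OF rv[OF j], symmetric]) simp
    also have "\<dots> = g j True * ennreal q + g j False * ennreal (1 - q)"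
      unfolding law[OF j] using q by (intro nn_integral_bernoulli_pmf) auto
    also have "\<dots> \<le> ennreal (exp (\<theta>\<^sup>2 * (q * (1 - q))))"
    proof (cases "a j")
      case True
      have "g j True * ennreal q + g j False * ennreal (1 - q)
        = ennreal (q * exp (\<theta> * (1 - q)) + (1 - q) * exp (- \<theta> * q))"
        unfolding g_def using q True by (simp add: ennreal_mult'[symmetric] ennreal_plus[symmetric] mult.commute del: ennreal_plus)
      also have "\<dots> \<le> ennreal (exp (\<theta>\<^sup>2 * (q * (1 - q))))"
        by (intro ennreal_leI bernoulli_centered_mgf_le q \<theta>)
      finally show ?thesis .
    next
      case False
      have "g j True * ennreal q + g j False * ennreal (1 - q) = ennreal 1"
        unfolding g_def using q False by (simp add: ennreal_plus[symmetric] del: ennreal_plus)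
      also have "\<dots> \<le> ennreal (exp (\<theta>\<^sup>2 * (q * (1 - q))))"
        using q by (intro ennreal_leI) simp
      finally show ?thesis .
    qed
    finally show "(\<integral>\<^sup>+\<omega>. g j (Y j \<omega>) \<partial>M) \<le> ennreal (exp (\<theta>\<^sup>2 * (q * (1 - q))))" .
  qed
  also have "\<dots> = ennreal (exp (\<theta>\<^sup>2 * (q * (1 - q) * real b)))"
    by (simp add: ennreal_power exp_of_nat_mult[symmetric] mult_ac)
  finally show ?thesis
    unfolding g_def by (simp only: prod_ennreal exp_ge_zero exp_sum[symmetric] sum_distrib_left finite_lessThan)
qed

lemma (in prob_space) nn_integral_poisson_arrivals_product:
  assumes pa: "poisson_arrivals M N X 0 1 f"
    and f: "\<And>u. 0 \<le> f u" "integrable lborel f"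
    and t: "0 \<le> t0" "t0 \<le> t1" "t1 \<le> 1" and s: "0 \<le> s"
  shows "(\<integral>\<^sup>+\<omega>. ennreal (real (arrivals_in N X t0 t1 \<omega>)) * ennreal (exp (- s * real (arrivals_in N X t1 1 \<omega>))) \<partial>M)
    = ennreal ((LBINT u:{t0..t1}. f u) * exp (- (1 - exp (- s)) * (LBINT u:{t1..1}. f u)))"
proof -
  \<comment> \<open>Independent increments are assumed along infinite nondecreasing grids, so the
    grid stays at 1 after \<open>t0\<close> and \<open>t1\<close>; the first two increments are the
    ones that count.\<close>
  define \<tau> where "\<tau> j = (if j = 0 then t0 else if j = 1 then t1 else 1)" for j :: nat
  define g where "g j n = (if j = (0::nat) then ennreal (real n) else ennreal (exp (- s * real n)))" for j n
  have N: "N \<in> measurable M (count_space UNIV)" "\<And>i. X i \<in> borel_measurable M"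
    using pa unfolding poisson_arrivals_def by auto
  note cnt [measurable] = measurable_arrivals_in[OF N]
  have law: "prob {\<omega> \<in> space M. arrivals_in N X a b \<omega> = n} = (LBINT u:{a..b}. f u) ^ n / fact n * exp (- (LBINT u:{a..b}. f u))"
    if "0 \<le> a" "a \<le> b" "b \<le> 1" for a b n
    using pa that unfolding poisson_arrivals_def by blast
  have "mono \<tau>" unfolding \<tau>_def using t by (intro monoI) auto
  moreover have "range \<tau> \<subseteq> {0..1}" unfolding \<tau>_def using t by auto
  ultimately have ind: "indep_vars (\<lambda>_. count_space UNIV) (\<lambda>j. arrivals_in N X (\<tau> j) (\<tau> (Suc j))) {..<2}"
    using pa unfolding poisson_arrivals_def by blast
  have "indep_vars (\<lambda>_. borel) (\<lambda>j \<omega>. g j (arrivals_in N X (\<tau> j) (\<tau> (Suc j)) \<omega>)) {..<2}"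
    by (rule indep_vars_compose2[OF ind]) simp
  then have "(\<integral>\<^sup>+\<omega>. (\<Prod>j<2. g j (arrivals_in N X (\<tau> j) (\<tau> (Suc j)) \<omega>)) \<partial>M)
     = (\<Prod>j<2. \<integral>\<^sup>+\<omega>. g j (arrivals_in N X (\<tau> j) (\<tau> (Suc j)) \<omega>) \<partial>M)"
    by (intro indep_vars_nn_integral) auto
  then have "(\<integral>\<^sup>+\<omega>. ennreal (real (arrivals_in N X t0 t1 \<omega>)) * ennreal (exp (- s * real (arrivals_in N X t1 1 \<omega>))) \<partial>M)
    = (\<integral>\<^sup>+\<omega>. ennreal (real (arrivals_in N X t0 t1 \<omega>)) \<partial>M) * (\<integral>\<^sup>+\<omega>. ennreal (exp (- s * real (arrivals_in N X t1 1 \<omega>))) \<partial>M)"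
    by (simp add: numeral_2_eq_2 lessThan_Suc g_def \<tau>_def mult.commute)
  also have "(\<integral>\<^sup>+\<omega>. ennreal (real (arrivals_in N X t0 t1 \<omega>)) \<partial>M) = ennreal (LBINT u:{t0..t1}. f u)"
    using t by (intro nn_integral_poisson[OF cnt law _ _ poisson_mean_sums] LBINT_Icc_nonneg f) auto
  also have "(\<integral>\<^sup>+\<omega>. ennreal (exp (- s * real (arrivals_in N X t1 1 \<omega>))) \<partial>M)
    = ennreal (exp (- (1 - exp (- s)) * (LBINT u:{t1..1}. f u)))"
    using t by (intro nn_integral_poisson[OF cnt law _ _ poisson_mgf_sums] LBINT_Icc_nonneg f) auto
  finally show ?thesis by (simp add: ennreal_mult'' )
qed

lemma partition_interval_mem:
  fixes x v :: real
  assumes "0 < x" "x \<le> v" "0 < n"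
  obtains j where "j < n" "v * real j / real n < x" "x \<le> v * real (Suc j) / real n"
proof -
  define Q where "Q j \<longleftrightarrow> x \<le> v * real (Suc j) / real n" for j
  have Q: "Q (n - 1)" using assms by (simp add: Q_def)
  define j where "j = (LEAST j. Q j)"
  have "Q j" unfolding j_def using Q by (rule LeastI)
  moreover have "j \<le> n - 1" unfolding j_def using Q by (rule Least_le)
  moreover have "v * real j / real n < x"
  proof (cases j)
    case (Suc j')
    have "\<not> Q j'" using not_less_Least[of j' Q] Suc unfolding j_def by simp
    then show ?thesis unfolding Q_def Suc by simp
  qed (use assms in simp)
  ultimately show ?thesis using assms(3) that[of j] unfolding Q_def by linarith
qed

text \<open>For a point in a given piece, the mass ahead is overestimated from the left end and the
  later arrivals are counted only beyond the right end. That count is independent of the number of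
  points in the piece. The piece itself adds at most \<open>a\<close> to the exponent, whence the
  factor \<open>exp a\<close>; by \<open>a \<le> 1 - exp (- s)\<close> the remaining decay is
  weakest at \<open>v\<close>.\<close>

lemma (in prob_space) nn_integral_poisson_arrivals_le:
  assumes pa: "poisson_arrivals M N X 0 1 f"
    and f: "\<And>u. 0 \<le> f u" "integrable lborel f"
    and v: "0 \<le> v" "v \<le> 1" and s: "0 \<le> s" and a: "0 \<le> a" "a \<le> 1 - exp (- s)"
  shows "(\<integral>\<^sup>+\<omega>. (\<Sum>i<N \<omega>. of_bool (X i \<omega> < v) *
        ennreal (exp (a * (LBINT u:{X i \<omega>..1}. f u) - s * real (N \<omega> - 1 - i)))) \<partial>M)
    \<le> ennreal (exp a * (LBINT u:{0..v}. f u) * exp (- (1 - exp (- s) - a) * (LBINT u:{v..1}. f u)))"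
proof -
  obtain n :: nat where n: "0 < n" "\<And>j. j < n \<Longrightarrow> (LBINT u:{v * j / n .. v * Suc j / n}. f u) \<le> 1"
    using LBINT_Icc_fine_partition[OF f v(1)] by metis
  define \<tau> where "\<tau> j = v * real j / real n" for j
  define m where "m a b = (LBINT u:{a..b}. f u)" for a b :: real
  define cnt where "cnt = arrivals_in N X"
  have \<tau>: "0 \<le> \<tau> j" "\<tau> j \<le> \<tau> (Suc j)" for j
    unfolding \<tau>_def using v by (simp_all add: divide_right_mono mult_left_mono)
  have \<tau>v: "\<tau> (Suc j) \<le> v" if "j < n" for j
  proof -
    have "v * real (Suc j) \<le> v * real n" using v that by (intro mult_left_mono) auto
    then show ?thesis unfolding \<tau>_def using n(1) by (simp add: field_simps)
  qed
  have N [measurable]: "N \<in> measurable M (count_space UNIV)" "\<And>i. X i \<in> borel_measurable M"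
    using pa unfolding poisson_arrivals_def by auto
  have [measurable]: "cnt a b \<in> measurable M (count_space UNIV)" for a b
    unfolding cnt_def by (rule measurable_arrivals_in[OF N])
  define W where "W j \<omega> = ennreal (exp (a * m (\<tau> j) 1)) * ennreal (exp (- s * real (cnt (\<tau> (Suc j)) 1 \<omega>)))" for j \<omega>
  have AE: "AE \<omega> in M. (\<forall>i<N \<omega>. 0 < X i \<omega> \<and> X i \<omega> \<le> 1) \<and> (\<forall>i j. i \<le> j \<and> j < N \<omega> \<longrightarrow> X i \<omega> \<le> X j \<omega>)"
    using pa unfolding poisson_arrivals_def by blast
  have "(\<integral>\<^sup>+\<omega>. (\<Sum>i<N \<omega>. of_bool (X i \<omega> < v) * ennreal (exp (a * m (X i \<omega>) 1 - s * real (N \<omega> - 1 - i)))) \<partial>M)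
    \<le> (\<integral>\<^sup>+\<omega>. (\<Sum>j<n. ennreal (real (cnt (\<tau> j) (\<tau> (Suc j)) \<omega>)) * W j \<omega>) \<partial>M)"
  proof (rule nn_integral_mono_AE)
    show "AE \<omega> in M. (\<Sum>i<N \<omega>. of_bool (X i \<omega> < v) * ennreal (exp (a * m (X i \<omega>) 1 - s * real (N \<omega> - 1 - i))))
      \<le> (\<Sum>j<n. ennreal (real (cnt (\<tau> j) (\<tau> (Suc j)) \<omega>)) * W j \<omega>)"
      using AE
    proof eventually_elim
      case (elim \<omega>)
      have "(\<Sum>i<N \<omega>. of_bool (X i \<omega> < v) * ennreal (exp (a * m (X i \<omega>) 1 - s * real (N \<omega> - 1 - i))))
        \<le> (\<Sum>i<N \<omega>. \<Sum>j<n. of_bool (\<tau> j < X i \<omega> \<and> X i \<omega> \<le> \<tau> (Suc j)) * W j \<omega>)"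
      proof (rule sum_mono)
        fix i assume "i \<in> {..<N \<omega>}"
        then have i: "i < N \<omega>" by simp
        show "of_bool (X i \<omega> < v) * ennreal (exp (a * m (X i \<omega>) 1 - s * real (N \<omega> - 1 - i)))
          \<le> (\<Sum>j<n. of_bool (\<tau> j < X i \<omega> \<and> X i \<omega> \<le> \<tau> (Suc j)) * W j \<omega>)"
        proof (cases "X i \<omega> < v")
          case True
          have "0 < X i \<omega>" "X i \<omega> \<le> v" using elim i True by auto
          then obtain j where j: "j < n" "\<tau> j < X i \<omega>" "X i \<omega> \<le> \<tau> (Suc j)"
            unfolding \<tau>_def using partition_interval_mem[OF _ _ n(1)] by metis
          \<comment> \<open>The points are sorted, so arrivals beyond the right end have indices
            above \<open>i\<close>, of which there are \<open>N \<omega> - 1 - i\<close>.\<close>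
          have "{i'. i' < N \<omega> \<and> \<tau> (Suc j) < X i' \<omega> \<and> X i' \<omega> \<le> 1} \<subseteq> {i<..<N \<omega>}"
          proof
            fix i' assume "i' \<in> {i'. i' < N \<omega> \<and> \<tau> (Suc j) < X i' \<omega> \<and> X i' \<omega> \<le> 1}"
            then have i': "i' < N \<omega>" "X i \<omega> < X i' \<omega>" using j(3) by auto
            have "\<not> i' \<le> i" using elim i i' by (metis leD)
            then show "i' \<in> {i<..<N \<omega>}" using i' by simp
          qed
          then have "cnt (\<tau> (Suc j)) 1 \<omega> \<le> card {i<..<N \<omega>}"
            unfolding cnt_def arrivals_in_def by (intro card_mono) auto
          then have "real (cnt (\<tau> (Suc j)) 1 \<omega>) \<le> real (N \<omega> - 1 - i)" by simp
          moreover have "m (X i \<omega>) 1 \<le> m (\<tau> j) 1"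
            unfolding m_def using j(2) by (intro LBINT_Icc_antimono f) auto
          ultimately have "a * m (X i \<omega>) 1 - s * real (N \<omega> - 1 - i) \<le> a * m (\<tau> j) 1 - s * real (cnt (\<tau> (Suc j)) 1 \<omega>)"
            using a(1) s by (intro diff_mono mult_left_mono)
          then have "ennreal (exp (a * m (X i \<omega>) 1 - s * real (N \<omega> - 1 - i))) \<le> W j \<omega>"
            unfolding W_def by (simp add: ennreal_mult'[symmetric] exp_add[symmetric] ennreal_leI)
          also have "\<dots> = of_bool (\<tau> j < X i \<omega> \<and> X i \<omega> \<le> \<tau> (Suc j)) * W j \<omega>" using j by simp
          also have "\<dots> \<le> (\<Sum>j<n. of_bool (\<tau> j < X i \<omega> \<and> X i \<omega> \<le> \<tau> (Suc j)) * W j \<omega>)"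
            using j(1) by (intro member_le_sum) auto
          finally show ?thesis using True by simp
        qed simp
      qed
      also have "\<dots> = (\<Sum>j<n. (\<Sum>i<N \<omega>. of_bool (\<tau> j < X i \<omega> \<and> X i \<omega> \<le> \<tau> (Suc j))) * W j \<omega>)"
        unfolding sum_distrib_right by (rule sum.swap)
      also have "\<dots> = (\<Sum>j<n. ennreal (real (cnt (\<tau> j) (\<tau> (Suc j)) \<omega>)) * W j \<omega>)"
        unfolding cnt_def arrivals_in_def of_nat_card_lessThan[symmetric] ennreal_of_nat_eq_real_of_nat ..
      finally show ?case .
    qed
  qed
  also have "\<dots> = (\<Sum>j<n. \<integral>\<^sup>+\<omega>. ennreal (real (cnt (\<tau> j) (\<tau> (Suc j)) \<omega>)) * W j \<omega> \<partial>M)"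
    unfolding W_def by (intro nn_integral_sum) measurable
  also have "\<dots> \<le> (\<Sum>j<n. ennreal (m (\<tau> j) (\<tau> (Suc j)) * (exp a * exp (- (1 - exp (- s) - a) * m v 1))))"
  proof (rule sum_mono)
    fix j assume "j \<in> {..<n}"
    then have j: "j < n" by simp
    let ?c = "1 - exp (- s)"
    have j1: "\<tau> (Suc j) \<le> 1" using \<tau>v[OF j] v by simp
    have "(\<integral>\<^sup>+\<omega>. ennreal (real (cnt (\<tau> j) (\<tau> (Suc j)) \<omega>)) * W j \<omega> \<partial>M)
      = (\<integral>\<^sup>+\<omega>. ennreal (exp (a * m (\<tau> j) 1)) * (ennreal (real (cnt (\<tau> j) (\<tau> (Suc j)) \<omega>)) * ennreal (exp (- s * real (cnt (\<tau> (Suc j)) 1 \<omega>)))) \<partial>M)"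
      unfolding W_def by (simp only: mult.left_commute)
    also have "\<dots> = ennreal (exp (a * m (\<tau> j) 1)) * (\<integral>\<^sup>+\<omega>. ennreal (real (cnt (\<tau> j) (\<tau> (Suc j)) \<omega>)) * ennreal (exp (- s * real (cnt (\<tau> (Suc j)) 1 \<omega>))) \<partial>M)"
      by (rule nn_integral_cmult) measurable
    also have "\<dots> = ennreal (exp (a * m (\<tau> j) 1)) * ennreal (m (\<tau> j) (\<tau> (Suc j)) * exp (- ?c * m (\<tau> (Suc j)) 1))"
      unfolding cnt_def m_def by (subst nn_integral_poisson_arrivals_product[OF pa f \<tau> j1 s]) (rule refl)
    also have "\<dots> = ennreal (m (\<tau> j) (\<tau> (Suc j)) * exp (a * m (\<tau> j) 1 - ?c * m (\<tau> (Suc j)) 1))"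
    proof -
      have "exp (a * m (\<tau> j) 1 - ?c * m (\<tau> (Suc j)) 1) = exp (a * m (\<tau> j) 1) * exp (- ?c * m (\<tau> (Suc j)) 1)"
        unfolding exp_add[symmetric] by (simp add: algebra_simps)
      then show ?thesis by (simp add: ennreal_mult'[symmetric] mult.left_commute)
    qed
    also have "\<dots> \<le> ennreal (m (\<tau> j) (\<tau> (Suc j)) * (exp a * exp (- (?c - a) * m v 1)))"
    proof (intro ennreal_leI mult_left_mono)
      have "m (\<tau> j) 1 = m (\<tau> j) (\<tau> (Suc j)) + m (\<tau> (Suc j)) 1"
        unfolding m_def by (rule LBINT_Icc_add[OF f \<tau>(2) j1])
      also have "\<dots> \<le> 1 + m (\<tau> (Suc j)) 1" using n(2)[OF j] unfolding m_def \<tau>_def by simp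
      finally have "a * m (\<tau> j) 1 \<le> a * (1 + m (\<tau> (Suc j)) 1)" using a(1) by (rule mult_left_mono)
      moreover have "m v 1 \<le> m (\<tau> (Suc j)) 1"
        unfolding m_def by (rule LBINT_Icc_antimono[OF f \<tau>v[OF j]])
      then have "(?c - a) * m v 1 \<le> (?c - a) * m (\<tau> (Suc j)) 1" using a(2) by (intro mult_left_mono) auto
      ultimately have "a * m (\<tau> j) 1 - ?c * m (\<tau> (Suc j)) 1 \<le> a + (- (?c - a) * m v 1)"
        by (simp add: algebra_simps)
      then show "exp (a * m (\<tau> j) 1 - ?c * m (\<tau> (Suc j)) 1) \<le> exp a * exp (- (?c - a) * m v 1)"
        unfolding exp_add[symmetric] by simp
      show "0 \<le> m (\<tau> j) (\<tau> (Suc j))" unfolding m_def by (rule LBINT_Icc_nonneg[OF f])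
    qed
    finally show "(\<integral>\<^sup>+\<omega>. ennreal (real (cnt (\<tau> j) (\<tau> (Suc j)) \<omega>)) * W j \<omega> \<partial>M)
      \<le> ennreal (m (\<tau> j) (\<tau> (Suc j)) * (exp a * exp (- (?c - a) * m v 1)))" .
  qed
  also have "\<dots> = ennreal ((\<Sum>j<n. m (\<tau> j) (\<tau> (Suc j))) * (exp a * exp (- (1 - exp (- s) - a) * m v 1)))"
    unfolding sum_distrib_right m_def
    by (intro sum_ennreal mult_nonneg_nonneg LBINT_Icc_nonneg f) auto
  also have "(\<Sum>j<n. m (\<tau> j) (\<tau> (Suc j))) = m 0 v"
    using LBINT_Icc_sum_partition[OF f v(1), of n n] n(1) unfolding m_def \<tau>_def by simp
  finally show ?thesis unfolding m_def by (simp only: mult_ac)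
qed

lemma (in prob_space) indep_set_sigma_sets_disjoint:
  assumes ind: "indep_sets E I" and st: "\<And>i. i \<in> I \<Longrightarrow> Int_stable (E i)"
    and AB: "A \<subseteq> I" "B \<subseteq> I" "A \<inter> B = {}"
  shows "indep_set (sigma_sets (space M) (\<Union>i\<in>A. E i)) (sigma_sets (space M) (\<Union>i\<in>B. E i))"
proof -
  have "indep_sets (\<lambda>j. sigma_sets (space M) (\<Union>i\<in>case_bool A B j. E i)) UNIV"
  proof (rule indep_sets_collect_sigma)
    have "(\<Union>j\<in>UNIV. case_bool A B j) \<subseteq> I" using AB by (auto split: bool.splits)
    then show "indep_sets E (\<Union>j\<in>UNIV. case_bool A B j)" by (rule indep_sets_mono_index) (rule ind)
    show "disjoint_family_on (case_bool A B) UNIV"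
      using AB(3) by (auto simp: disjoint_family_on_def split: bool.splits)
    fix i j assume "i \<in> case_bool A B j"
    then have "i \<in> I" using AB by (cases j) auto
    then show "Int_stable (E i)" by (rule st)
  qed
  also have "(\<lambda>j. sigma_sets (space M) (\<Union>i\<in>case_bool A B j. E i)) =
    case_bool (sigma_sets (space M) (\<Union>i\<in>A. E i)) (sigma_sets (space M) (\<Union>i\<in>B. E i))"
    by (auto simp: fun_eq_iff split: bool.split)
  finally show ?thesis unfolding indep_set_def .
qed

section \<open>Measurability\<close>

context
  fixes P :: params and M :: "stage2 measure"
  assumes valid: "valid_params P" and law: "stage2_law P M"
begin

text \<open>The rate vanishes outside the day, so integrability over [0,1] is integrability over the
  line, as the results on interval masses require.\<close>

lemma walk_rate_props:
  assumes "k \<in> {1..horizon P}"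
  shows "0 \<le> walk_rate P k u" "integrable lborel (walk_rate P k)"
proof -
  have v: "\<And>u. 0 \<le> walk_rate P k u" "\<And>u. u \<notin> {0..1} \<Longrightarrow> walk_rate P k u = 0"
    "set_integrable lborel {0..1} (walk_rate P k)"
    using valid assms unfolding valid_params_def by blast+
  show "0 \<le> walk_rate P k u" by (rule v(1))
  have "(\<lambda>u. indicator {0..1} u *\<^sub>R walk_rate P k u) = walk_rate P k"
    using v(2) by (auto simp: fun_eq_iff indicator_def)
  then show "integrable lborel (walk_rate P k)"
    using v(3) unfolding set_integrable_def by simp
qed

lemma stage2_measurable:
  assumes "k \<in> {1..horizon P}"
  shows "(\<lambda>\<omega>. walk_num \<omega> k) \<in> measurable M (count_space UNIV)"
    and "(\<lambda>\<omega>. walk_time \<omega> k i) \<in> borel_measurable M"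
    and "(\<lambda>\<omega>. check_time \<omega> k i) \<in> borel_measurable M"
    and "(\<lambda>\<omega>. shows_up \<omega> k i) \<in> measurable M (count_space UNIV)"
    and "(\<lambda>\<omega>. stay1 \<omega> k i) \<in> measurable M (count_space UNIV)"
    and "(\<lambda>\<omega>. stay2 \<omega> k i) \<in> measurable M (count_space UNIV)"
proof -
  have l: "poisson_arrivals M (\<lambda>\<omega>. walk_num \<omega> k) (\<lambda>i \<omega>. walk_time \<omega> k i) 0 1 (walk_rate P k)"
    "distributed M lborel (\<lambda>\<omega>. check_time \<omega> k i) (\<lambda>u. ennreal (check_density P k u))"
    "(\<lambda>\<omega>. shows_up \<omega> k i) \<in> measurable M (count_space UNIV)"
    "(\<lambda>\<omega>. stay1 \<omega> k i) \<in> measurable M (count_space UNIV)"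
    "(\<lambda>\<omega>. stay2 \<omega> k i) \<in> measurable M (count_space UNIV)"
    using law assms unfolding stage2_law_def by blast+
  show "(\<lambda>\<omega>. walk_num \<omega> k) \<in> measurable M (count_space UNIV)"
    "(\<lambda>\<omega>. walk_time \<omega> k i) \<in> borel_measurable M"
    using l(1) unfolding poisson_arrivals_def by blast+
  show "(\<lambda>\<omega>. check_time \<omega> k i) \<in> borel_measurable M"
    using distributed_measurable[OF l(2)] by simp
qed (use law assms in \<open>unfold stage2_law_def, blast+\<close>)

lemma measurable_dass2_estimate:
  assumes k: "k \<in> {1..horizon P}" and m: "(\<lambda>u. walk_mass P k u 1) \<in> borel_measurable borel"
  shows "(\<lambda>\<omega>. dass2_estimate P \<alpha> \<omega> k b (walk_time \<omega> k i) w) \<in> borel_measurable M"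
proof -
  note stage2_measurable[OF k, measurable] and m[measurable]
  show ?thesis unfolding dass2_estimate_def Let_def by measurable
qed

text \<open>The accepted set takes values in the finite power set of \<open>{..<n}\<close>. Over a
  countable range the next decision can be composed value by value, and for a fixed value it
  compares measurable reals.\<close>

lemma measurable_dass2_walk_ins:
  assumes k: "k \<in> {1..horizon P}" and m: "(\<lambda>u. walk_mass P k u 1) \<in> borel_measurable borel"
    and c [measurable]: "c \<in> borel_measurable M"
  shows "(\<lambda>\<omega>. dass2_walk_ins P \<alpha> \<omega> k b (c \<omega>) n) \<in> measurable M (count_space (Pow {..<n}))"
proof (induction n)
  case 0
  show ?case by simp
next
  case (Suc n)
  note measurable_dass2_estimate[OF k m, measurable]
  define f where "f A \<omega> = (if dass2_estimate P \<alpha> \<omega> k b (walk_time \<omega> k n) (card A) < c \<omega> then insert n A else A)" for A \<omega>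
  have "(\<lambda>\<omega>. f (dass2_walk_ins P \<alpha> \<omega> k b (c \<omega>) n) \<omega>) \<in> measurable M (count_space (Pow {..<Suc n}))"
  proof (rule measurable_compose_countable'[OF _ Suc.IH])
    fix A :: "nat set" assume "A \<in> Pow {..<n}"
    then have "insert n A \<in> Pow {..<Suc n}" "A \<in> Pow {..<Suc n}" by auto
    then show "f A \<in> measurable M (count_space (Pow {..<Suc n}))"
      unfolding f_def by (intro measurable_If measurable_const) (simp_all, measurable)
  qed (simp add: countable_finite)
  then show ?case unfolding f_def by (simp add: Let_def)
qed

lemma measurable_mem_dass2_walk_ins:
  assumes k: "k \<in> {1..horizon P}" and m: "(\<lambda>u. walk_mass P k u 1) \<in> borel_measurable borel"
    and c: "c \<in> borel_measurable M"
  shows "Measurable.pred M (\<lambda>\<omega>. j \<in> dass2_walk_ins P \<alpha> \<omega> k b (c \<omega>) (walk_num \<omega> k))"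
proof (rule measurable_compose_countable[OF _ stage2_measurable(1)[OF k]])
  fix n
  show "Measurable.pred M (\<lambda>\<omega>. j \<in> dass2_walk_ins P \<alpha> \<omega> k b (c \<omega>) n)"
    by (rule measurable_compose[OF measurable_dass2_walk_ins[OF k m c]]) simp
qed

lemma measurable_dass2_day:
  assumes k: "k \<in> {1..horizon P}" and m: "(\<lambda>u. walk_mass P k u 1) \<in> borel_measurable borel"
    and c [measurable]: "c \<in> borel_measurable M"
  shows "Measurable.pred M (\<lambda>\<omega>. take1 (dass2_day P \<alpha> \<omega> k b (c \<omega>)) i)"
    and "Measurable.pred M (\<lambda>\<omega>. take2 (dass2_day P \<alpha> \<omega> k b (c \<omega>)) i)"
proof -
  note stage2_measurable[OF k, measurable] measurable_mem_dass2_walk_ins[OF k m c, measurable]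
  show "Measurable.pred M (\<lambda>\<omega>. take1 (dass2_day P \<alpha> \<omega> k b (c \<omega>)) i)"
    unfolding dass2_day_def Let_def decision.simps by measurable
  show "Measurable.pred M (\<lambda>\<omega>. take2 (dass2_day P \<alpha> \<omega> k b (c \<omega>)) i)"
    unfolding dass2_day_def Let_def decision.simps by measurable
qed

lemma measurable_occupants:
  assumes k': "k' \<in> {1..horizon P}"
    and z [measurable]: "\<And>i. Measurable.pred M (\<lambda>\<omega>. take1 (z \<omega> k') i)" "\<And>i. Measurable.pred M (\<lambda>\<omega>. take2 (z \<omega> k') i)"
  shows "(\<lambda>\<omega>. real (occupants \<omega> B (z \<omega>) k k')) \<in> borel_measurable M"
proof -
  note stage2_measurable[OF k', measurable]
  show ?thesis unfolding occupants_def of_nat_add by measurable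
qed

lemma measurable_room_capacity:
  assumes k: "k \<le> Suc (horizon P)"
    and z: "\<And>k' i. k' \<in> {1..<k} \<Longrightarrow> Measurable.pred M (\<lambda>\<omega>. take1 (z \<omega> k') i)"
      "\<And>k' i. k' \<in> {1..<k} \<Longrightarrow> Measurable.pred M (\<lambda>\<omega>. take2 (z \<omega> k') i)"
  shows "(\<lambda>\<omega>. room_capacity P \<omega> B (z \<omega>) k) \<in> borel_measurable M"
    and "(\<lambda>\<omega>. real (prior_occupancy \<omega> B (z \<omega>) k)) \<in> borel_measurable M"
proof -
  have occ: "(\<lambda>\<omega>. real (occupants \<omega> B (z \<omega>) k k')) \<in> borel_measurable M" if "k' \<in> {1..<k}" for k'
    using that k by (intro measurable_occupants z) auto
  show "(\<lambda>\<omega>. room_capacity P \<omega> B (z \<omega>) k) \<in> borel_measurable M"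
  proof (cases "duration P")
    case (Geometric q)
    show ?thesis
      unfolding room_capacity_def Geometric duration.case
      by (intro borel_measurable_diff borel_measurable_const borel_measurable_sum occ)
  qed (simp add: room_capacity_def)
  show "(\<lambda>\<omega>. real (prior_occupancy \<omega> B (z \<omega>) k)) \<in> borel_measurable M"
    unfolding prior_occupancy_def of_nat_sum by (intro borel_measurable_sum occ)
qed

text \<open>The capacity of a day depends only on decisions of earlier days, so measurability
  propagates by induction over the days.\<close>

lemma measurable_dass2:
  assumes m: "\<And>k. k \<in> {1..horizon P} \<Longrightarrow> (\<lambda>u. walk_mass P k u 1) \<in> borel_measurable borel"
    and K: "K \<le> horizon P"
  shows "Measurable.pred M (\<lambda>\<omega>. take1 (dass2 P \<alpha> \<omega> B K k) i) \<and>
    Measurable.pred M (\<lambda>\<omega>. take2 (dass2 P \<alpha> \<omega> B K k) i)"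
  using K
proof (induction K arbitrary: k i)
  case (Suc K)
  then have IH: "Measurable.pred M (\<lambda>\<omega>. take1 (dass2 P \<alpha> \<omega> B K k) i)"
    "Measurable.pred M (\<lambda>\<omega>. take2 (dass2 P \<alpha> \<omega> B K k) i)" for k i
    by auto
  have K: "Suc K \<in> {1..horizon P}" using Suc.prems by simp
  have c: "(\<lambda>\<omega>. room_capacity P \<omega> B (dass2 P \<alpha> \<omega> B K) (Suc K)) \<in> borel_measurable M"
    using Suc.prems by (intro measurable_room_capacity IH) auto
  show ?case
  proof (cases "k = Suc K")
    case True
    then show ?thesis using measurable_dass2_day[OF K m[OF K] c] by (simp add: Let_def)
  next
    case False
    then show ?thesis using IH by (simp add: Let_def)
  qed
qed simp

lemma measurable_served:
  assumes k: "k \<in> {1..horizon P}"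
    and z [measurable]: "\<And>i. Measurable.pred M (\<lambda>\<omega>. take1 (z \<omega>) i)" "\<And>i. Measurable.pred M (\<lambda>\<omega>. take2 (z \<omega>) i)"
  shows "(\<lambda>\<omega>. real (served1 \<omega> k b (z \<omega>))) \<in> borel_measurable M"
    and "(\<lambda>\<omega>. real (refused1 \<omega> k b (z \<omega>))) \<in> borel_measurable M"
    and "(\<lambda>\<omega>. real (served2 \<omega> k (z \<omega>))) \<in> borel_measurable M"
proof -
  note stage2_measurable[OF k, measurable]
  show "(\<lambda>\<omega>. real (served1 \<omega> k b (z \<omega>))) \<in> borel_measurable M" unfolding served1_def by measurable
  show "(\<lambda>\<omega>. real (refused1 \<omega> k b (z \<omega>))) \<in> borel_measurable M" unfolding refused1_def by measurable
  show "(\<lambda>\<omega>. real (served2 \<omega> k (z \<omega>))) \<in> borel_measurable M" unfolding served2_def by measurable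
qed

lemma measurable_day_loss:
  assumes k: "k \<in> {1..horizon P}"
    and h: "\<And>k' i. k' \<in> {1..<k} \<Longrightarrow> Measurable.pred M (\<lambda>\<omega>. take1 (h \<omega> k') i)"
      "\<And>k' i. k' \<in> {1..<k} \<Longrightarrow> Measurable.pred M (\<lambda>\<omega>. take2 (h \<omega> k') i)"
    and z: "\<And>i. Measurable.pred M (\<lambda>\<omega>. take1 (z \<omega>) i)" "\<And>i. Measurable.pred M (\<lambda>\<omega>. take2 (z \<omega>) i)"
  shows "(\<lambda>\<omega>. day_loss P \<omega> B (h \<omega>) k (z \<omega>)) \<in> borel_measurable M"
proof -
  have "k \<le> Suc (horizon P)" using k by simp
  note [measurable] = measurable_room_capacity(2)[OF this h] measurable_served[OF k z]
  show ?thesis unfolding day_loss_def by measurable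
qed

text \<open>\<open>arg_min\<close> chooses among the minimizers without any guarantee of measurable
  dependence on the path. The minimal loss, however, has a closed form; on negative capacity the
  decision is one fixed value.\<close>

lemma measurable_loss_offline_opt:
  assumes k: "k \<in> {1..horizon P}"
    and h: "\<And>k' i. k' \<in> {1..<k} \<Longrightarrow> Measurable.pred M (\<lambda>\<omega>. take1 (h \<omega> k') i)"
      "\<And>k' i. k' \<in> {1..<k} \<Longrightarrow> Measurable.pred M (\<lambda>\<omega>. take2 (h \<omega> k') i)"
    and nonneg: "0 \<le> over_loss P k" "0 \<le> revenue P k"
  shows "(\<lambda>\<omega>. loss P \<omega> B (offline_opt P \<omega> B (h \<omega>) k) k) \<in> borel_measurable M"
proof -
  have k1: "1 \<le> k" "k \<le> Suc (horizon P)" using k by auto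
  define c where "c \<omega> = room_capacity P \<omega> B (h \<omega>) k" for \<omega> :: stage2
  define S where "S \<omega> = show_ups \<omega> k (B k)" for \<omega> :: stage2
  have [measurable]: "c \<in> borel_measurable M"
    unfolding c_def by (rule measurable_room_capacity(1)[OF k1(2) h])
  note [measurable] = measurable_room_capacity(2)[OF k1(2) h] stage2_measurable[OF k]
  have [measurable]: "S \<in> measurable M (count_space UNIV)" unfolding S_def show_ups_def by measurable
  have [measurable]: "(\<lambda>\<omega>. day_loss P \<omega> B (h \<omega>) k (SOME z. False)) \<in> borel_measurable M"
    by (rule measurable_day_loss[OF k h]) simp_all
  have "loss P \<omega> B (offline_opt P \<omega> B (h \<omega>) k) k = (if c \<omega> < 0 then day_loss P \<omega> B (h \<omega>) k (SOME z. False)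
    else over_loss P k * (real (S \<omega>) - min (real (S \<omega>)) (real_of_int \<lfloor>c \<omega>\<rfloor>)) +
      revenue P k * (real (capacity P) - real (prior_occupancy \<omega> B (h \<omega>) k)
        - min (real (S \<omega>) + real (walk_num \<omega> k)) (real_of_int \<lfloor>c \<omega>\<rfloor>)))" for \<omega>
  proof (cases "c \<omega> < 0")
    case True
    then show ?thesis using loss_offline_opt_infeasible[OF k1(1)] unfolding c_def by simp
  next
    case False
    then have "real (nat \<lfloor>c \<omega>\<rfloor>) = real_of_int \<lfloor>c \<omega>\<rfloor>" by simp
    then show ?thesis
      using False loss_offline_opt_feasible[OF k1(1) _ nonneg, of \<omega> B "h \<omega>"]
      unfolding c_def S_def of_nat_min of_nat_add by simp
  qed
  then show ?thesis by simp
qed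

end

section \<open>Expected regret\<close>

definition source_algebra :: "stage2 measure \<Rightarrow> source2 set \<Rightarrow> stage2 measure" where
  "source_algebra M A = sigma (space M) (\<Union>s\<in>A. source2_events M s)"

lemma source2_events_subset: "source2_events M s \<subseteq> Pow (space M)"
proof -
  have sub: "sets (vimage_algebra (space M) f N) \<subseteq> Pow (space M)" for f :: "stage2 \<Rightarrow> 'b" and N
    using sets.space_closed[of "vimage_algebra (space M) f N"] by simp
  show ?thesis by (cases s) (simp_all only: source2_events.simps sub)
qed

lemma Int_stable_source2_events: "Int_stable (source2_events M s)"
  by (cases s) (simp_all only: source2_events.simps sets.Int_stable)

lemma space_source_algebra [simp]: "space (source_algebra M A) = space M"
  unfolding source_algebra_def by (rule space_measure_of) (use source2_events_subset in blast)

lemma sets_source_algebra: "sets (source_algebra M A) = sigma_sets (space M) (\<Union>s\<in>A. source2_events M s)"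
  unfolding source_algebra_def by (rule sets_measure_of) (use source2_events_subset in blast)

lemma measurable_source_algebra:
  assumes "s \<in> A" "source2_events M s = sets (vimage_algebra (space M) g N)"
    and "g \<in> space M \<rightarrow> space N" "h \<in> measurable N L"
  shows "(\<lambda>\<omega>. h (g \<omega>)) \<in> measurable (source_algebra M A) L"
proof -
  have "(\<lambda>\<omega>. h (g \<omega>)) \<in> measurable (vimage_algebra (space M) g N) L"
    using assms(3,4) by (intro measurable_compose[OF measurable_vimage_algebra1]) auto
  moreover have "sets (vimage_algebra (space M) g N) \<subseteq> sets (source_algebra M A)"
    unfolding sets_source_algebra assms(2)[symmetric] using assms(1) by (auto intro: sigma_sets.Basic)
  ultimately show ?thesis
    using measurable_mono[of L L "vimage_algebra (space M) g N" "source_algebra M A"] by auto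
qed

lemma measurable_source_algebra_coordinates:
  "Walk_Ins k \<in> A \<Longrightarrow> (\<lambda>\<omega>. walk_num \<omega> k) \<in> measurable (source_algebra M A) (count_space UNIV)"
  "Walk_Ins k \<in> A \<Longrightarrow> (\<lambda>\<omega>. walk_time \<omega> k i) \<in> borel_measurable (source_algebra M A)"
  "Check_Time k j \<in> A \<Longrightarrow> (\<lambda>\<omega>. check_time \<omega> k j) \<in> borel_measurable (source_algebra M A)"
  "Shows_Up k j \<in> A \<Longrightarrow> (\<lambda>\<omega>. shows_up \<omega> k j) \<in> measurable (source_algebra M A) (count_space UNIV)"
proof -
  let ?g = "\<lambda>\<omega>. (walk_num \<omega> k, walk_time \<omega> k)" and ?N = "count_space UNIV \<Otimes>\<^sub>M (\<Pi>\<^sub>M i\<in>UNIV. borel)"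
  have g: "?g \<in> space M \<rightarrow> space ?N" by (simp add: space_pair_measure space_PiM)
  show "(\<lambda>\<omega>. walk_num \<omega> k) \<in> measurable (source_algebra M A) (count_space UNIV)" if "Walk_Ins k \<in> A"
    using measurable_source_algebra[OF that source2_events.simps(1) g measurable_fst] by simp
  have "(\<lambda>p. snd p i) \<in> borel_measurable ?N" by measurable
  from measurable_source_algebra[OF _ source2_events.simps(1) g this]
  show "(\<lambda>\<omega>. walk_time \<omega> k i) \<in> borel_measurable (source_algebra M A)" if "Walk_Ins k \<in> A"
    using that by simp
  show "(\<lambda>\<omega>. check_time \<omega> k j) \<in> borel_measurable (source_algebra M A)" if "Check_Time k j \<in> A"
    using measurable_source_algebra[OF that source2_events.simps(2) _ measurable_ident] by simp
  show "(\<lambda>\<omega>. shows_up \<omega> k j) \<in> measurable (source_algebra M A) (count_space UNIV)" if "Shows_Up k j \<in> A"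
    using measurable_source_algebra[OF that source2_events.simps(3) _ measurable_ident] by simp
qed

text \<open>Stays only end: \<open>k - k'\<close> grows with \<open>k\<close>, so whoever still has
  a room on the next day had it on day \<open>k\<close>.\<close>

lemma prior_occupancy_Suc:
  "1 \<le> k \<Longrightarrow> prior_occupancy \<omega> B z (Suc k) \<le>
     prior_occupancy \<omega> B z k + (served1 \<omega> k (B k) (z k) + served2 \<omega> k (z k))"
proof -
  assume "1 \<le> k"
  then have "{1..<Suc k} = insert k {1..<k}" by auto
  then have "prior_occupancy \<omega> B z (Suc k) = occupants \<omega> B z (Suc k) k + (\<Sum>k'=1..<k. occupants \<omega> B z (Suc k) k')"
    unfolding prior_occupancy_def by simp
  also have "\<dots> \<le> occupants \<omega> B z k k + (\<Sum>k'=1..<k. occupants \<omega> B z k k')"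
    unfolding occupants_def by (intro add_mono sum_mono card_mono) auto
  also have "occupants \<omega> B z k k = served1 \<omega> k (B k) (z k) + served2 \<omega> k (z k)"
    unfolding occupants_def served1_def served2_def by simp
  finally show ?thesis unfolding prior_occupancy_def by simp
qed

context
  fixes P :: params and M :: "stage2 measure"
  assumes valid: "valid_params P" and law: "stage2_law P M"
begin

interpretation prob_space M
  using law unfolding stage2_law_def by blast

private lemma walk_mass_nonneg: "k \<in> {1..horizon P} \<Longrightarrow> 0 \<le> walk_mass P k a b"
  unfolding walk_mass_def by (intro LBINT_Icc_nonneg walk_rate_props[OF valid law])

private lemma walk_mass_measurable: "k \<in> {1..horizon P} \<Longrightarrow> (\<lambda>u. walk_mass P k u b) \<in> borel_measurable borel"
  unfolding walk_mass_def by (intro borel_measurable_LBINT_Icc walk_rate_props[OF valid law])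

private lemma confirm_rate_bounds: "k \<in> {1..horizon P} \<Longrightarrow> 0 \<le> confirm_rate P k \<and> confirm_rate P k \<le> 1"
  using valid unfolding valid_params_def confirm_rate_def by blast

private lemma arrivals: "k \<in> {1..horizon P} \<Longrightarrow>
    poisson_arrivals M (\<lambda>\<omega>. walk_num \<omega> k) (\<lambda>i \<omega>. walk_time \<omega> k i) 0 1 (walk_rate P k)"
  using law unfolding stage2_law_def by blast

private lemma indep_source_algebras:
  assumes "A \<subseteq> {s. source2_day s \<in> {1..horizon P}}" "B \<subseteq> {s. source2_day s \<in> {1..horizon P}}" "A \<inter> B = {}"
  shows "indep_set (sets (source_algebra M A)) (sets (source_algebra M B))"
  unfolding sets_source_algebra
proof (rule indep_set_sigma_sets_disjoint[OF _ Int_stable_source2_events assms])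
  show "indep_sets (source2_events M) {s. source2_day s \<in> {1..horizon P}}"
    using law unfolding stage2_law_def by blast
qed

section \<open>Generic paths and nonnegative room capacity\<close>

lemma AE_check_time_neq:
  assumes k: "k \<in> {1..horizon P}" and ij: "i \<noteq> j"
  shows "AE \<omega> in M. check_time \<omega> k i \<noteq> check_time \<omega> k j"
proof -
  let ?F = "source_algebra M {Check_Time k i}" and ?G = "source_algebra M {Check_Time k j}"
  note stage2_measurable[OF valid law k, measurable]
  have [measurable]: "(\<lambda>\<omega>. check_time \<omega> k i) \<in> borel_measurable ?F" "(\<lambda>\<omega>. check_time \<omega> k j) \<in> borel_measurable ?G"
    by (rule measurable_source_algebra_coordinates; simp)+
  define f where "f p = (if check_time (fst p) k i = check_time (snd p) k j then 1 else 0 :: ennreal)" for p :: "stage2 \<times> stage2"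
  have ind: "indep_set (sets ?F) (sets ?G)" using k ij by (intro indep_source_algebras) auto
  have f: "f \<in> borel_measurable (?F \<Otimes>\<^sub>M ?G)" unfolding f_def by measurable
  have "(\<integral>\<^sup>+x. f (x, x) \<partial>M) = (\<integral>\<^sup>+x. \<integral>\<^sup>+y. f (x, y) \<partial>M \<partial>M)"
    by (rule nn_integral_decouple[OF ind _ _ f]) simp_all
  also have "\<dots> = (\<integral>\<^sup>+x. 0 \<partial>M)"
  \<comment> \<open>With the check-in time of \<open>i\<close> frozen, that of \<open>j\<close>
    still has a density and avoids a single point almost surely.\<close>
  proof (intro nn_integral_cong)
    fix x :: stage2
    have "distributed M lborel (\<lambda>\<omega>. check_time \<omega> k j) (\<lambda>u. ennreal (check_density P k u))"
      using law k unfolding stage2_law_def by blast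
    from distributed_AE2[OF this, of "\<lambda>u. u \<noteq> check_time x k i"]
    have "AE y in M. check_time y k j \<noteq> check_time x k i"
      using AE_lborel_singleton[of "check_time x k i"] by (auto elim: eventually_mono)
    then have "AE y in M. f (x, y) = 0" by eventually_elim (simp add: f_def)
    then have "(\<integral>\<^sup>+y. f (x, y) \<partial>M) = (\<integral>\<^sup>+y. 0 \<partial>M)" by (rule nn_integral_cong_AE)
    then show "(\<integral>\<^sup>+y. f (x, y) \<partial>M) = 0" by simp
  qed
  finally have "(\<integral>\<^sup>+x. f (x, x) \<partial>M) = 0" by simp
  moreover have "(\<lambda>x. f (x, x)) \<in> borel_measurable M" unfolding f_def by simp
  ultimately have "AE x in M. f (x, x) = 0" by (simp add: nn_integral_0_iff_AE)
  then show ?thesis by eventually_elim (auto simp: f_def split: if_splits)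
qed

lemma AE_arrivals_generic:
  "AE \<omega> in M. \<forall>k\<in>{1..horizon P}.
     (\<forall>i j. i \<le> j \<and> j < walk_num \<omega> k \<longrightarrow> walk_time \<omega> k i \<le> walk_time \<omega> k j) \<and> inj (check_time \<omega> k)"
proof (intro AE_ball_countable[THEN iffD2] ballI AE_conjI)
  fix k assume k: "k \<in> {1..horizon P}"
  show "AE \<omega> in M. \<forall>i j. i \<le> j \<and> j < walk_num \<omega> k \<longrightarrow> walk_time \<omega> k i \<le> walk_time \<omega> k j"
    using arrivals[OF k] unfolding poisson_arrivals_def by auto
  have "AE \<omega> in M. \<forall>i j. i \<noteq> j \<longrightarrow> check_time \<omega> k i \<noteq> check_time \<omega> k j"
    unfolding AE_all_countable using AE_check_time_neq[OF k] by auto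
  then show "AE \<omega> in M. inj (check_time \<omega> k)"
    by eventually_elim (auto simp: inj_def)
qed simp

text \<open>For geometric stays the capacity is the integer of rooms not held by earlier guests;
  each day DASS-II takes at most that many, and overnight rooms can only become free.\<close>

lemma room_capacity_dass2_nonneg:
  assumes \<alpha>: "0 \<le> \<alpha>" and K: "K < horizon P"
    and generic: "\<forall>k\<in>{1..horizon P}.
     (\<forall>i j. i \<le> j \<and> j < walk_num \<omega> k \<longrightarrow> walk_time \<omega> k i \<le> walk_time \<omega> k j) \<and> inj (check_time \<omega> k)"
  shows "0 \<le> room_capacity P \<omega> B (dass2 P \<alpha> \<omega> B K) (Suc K)"
proof (cases "duration P")
  case (Constant d)
  then show ?thesis by (simp add: room_capacity_def)
next
  case (Geometric q)
  have room: "room_capacity P \<omega> B z k = real (capacity P) - real (prior_occupancy \<omega> B z k)" for z k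
    unfolding room_capacity_def Geometric duration.case prior_occupancy_def of_nat_sum ..
  show ?thesis using K
  proof (induction K)
    case 0
    then show ?case unfolding room prior_occupancy_def by simp
  next
    case (Suc K)
    let ?k = "Suc K" and ?h = "dass2 P \<alpha> \<omega> B K"
    let ?c = "room_capacity P \<omega> B ?h ?k"
    let ?z = "dass2_day P \<alpha> \<omega> ?k (B ?k) ?c"
    have k: "?k \<in> {1..horizon P}" using Suc.prems by simp
    have IH: "0 \<le> ?c" using Suc by simp
    have dass2: "dass2 P \<alpha> \<omega> B ?k = ?h(?k := ?z)" by (simp add: Let_def)
    have c_int: "?c = real_of_int (int (capacity P) - int (prior_occupancy \<omega> B ?h ?k))" unfolding room by simp
    have "real (card {i. i < B ?k \<and> shows_up \<omega> ?k i \<and> take1 ?z i})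
        + real (card (dass2_walk_ins P \<alpha> \<omega> ?k (B ?k) ?c (walk_num \<omega> ?k))) \<le> ?c"
    proof (rule dass2_taken_le[OF _ _ c_int IH])
      show "0 \<le> confirm_rate P ?k" using confirm_rate_bounds[OF k] by simp
      show "0 \<le> \<alpha> * walk_mass P ?k u 1" for u using \<alpha> walk_mass_nonneg[OF k] by simp
      show "walk_time \<omega> ?k i \<le> walk_time \<omega> ?k j" if "i \<le> j" "j < walk_num \<omega> ?k" for i j
        using generic k that by blast
      show "inj_on (check_time \<omega> ?k) {..<B ?k}"
        using generic k by (blast intro: inj_on_subset)
    qed
    then have taken: "real (served1 \<omega> ?k (B ?k) ?z) + real (served2 \<omega> ?k ?z) \<le> ?c"
      unfolding served1_def served2_def dass2_taken2 .
    have "prior_occupancy \<omega> B (?h(?k := ?z)) (Suc ?k) \<le>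
      prior_occupancy \<omega> B ?h ?k + (served1 \<omega> ?k (B ?k) ?z + served2 \<omega> ?k ?z)"
      using prior_occupancy_Suc[of ?k \<omega> B "?h(?k := ?z)"] unfolding prior_occupancy_upd fun_upd_same by simp
    then have "real (prior_occupancy \<omega> B (?h(?k := ?z)) (Suc ?k)) \<le>
      real (prior_occupancy \<omega> B ?h ?k) + (real (served1 \<omega> ?k (B ?k) ?z) + real (served2 \<omega> ?k ?z))"
      by linarith
    then show ?case using taken unfolding dass2 room by linarith
  qed
qed

text \<open>Walk-ins and check-in times lie in \<open>F\<close>, the outcomes of the reservations in
  \<open>G\<close>. With \<open>F\<close> frozen, the random times at which the excess is read
  become constants; the moment bound \<open>V\<close> is the same for all of them and factors out of
  the sum before the Poisson expectation is taken. Both signs of \<open>\<theta>\<close> are needed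
  later.\<close>

lemma nn_integral_walk_ins_excess_le:
  assumes k: "k \<in> {1..horizon P}" and v: "0 \<le> v" "v \<le> 1"
    and \<theta>: "\<bar>\<theta>\<bar> \<le> 1" and s: "0 \<le> s" and a: "0 \<le> a" "a \<le> 1 - exp (- s)"
  shows "(\<integral>\<^sup>+\<omega>. (\<Sum>i<walk_num \<omega> k. of_bool (walk_time \<omega> k i < v) *
        ennreal (exp (a * walk_mass P k (walk_time \<omega> k i) 1 - s * real (walk_num \<omega> k - 1 - i))) *
        ennreal (exp (\<theta> * show_up_excess P \<omega> k b (walk_time \<omega> k i)))) \<partial>M)
    \<le> ennreal (exp (\<theta>\<^sup>2 * (confirm_rate P k * (1 - confirm_rate P k) * real b)) *
        (exp a * walk_mass P k 0 v * exp (- (1 - exp (- s) - a) * walk_mass P k v 1)))"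
proof -
  define q where "q = confirm_rate P k"
  define V where "V = ennreal (exp (\<theta>\<^sup>2 * (q * (1 - q) * real b)))"
  define F where "F = source_algebra M (insert (Walk_Ins k) (range (Check_Time k)))"
  define G where "G = source_algebra M (range (Shows_Up k))"
  define Z where "Z i x = of_bool (walk_time x k i < v) *
      ennreal (exp (a * walk_mass P k (walk_time x k i) 1 - s * real (walk_num x k - 1 - i)))" for i and x :: stage2
  define h where "h x y u = (\<Sum>j<b. of_bool (u < check_time x k j) * (of_bool (shows_up y k j) - q))" for x y :: stage2 and u
  define f where "f p = (\<Sum>i<walk_num (fst p) k. Z i (fst p) *
      ennreal (exp (\<theta> * h (fst p) (snd p) (walk_time (fst p) k i))))" for p
  note [measurable] = walk_mass_measurable[OF k]
  have [measurable]: "(\<lambda>\<omega>. walk_num \<omega> k) \<in> measurable F (count_space UNIV)"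
    "\<And>i. (\<lambda>\<omega>. walk_time \<omega> k i) \<in> borel_measurable F"
    "\<And>i. (\<lambda>\<omega>. check_time \<omega> k i) \<in> borel_measurable F"
    "\<And>i. (\<lambda>\<omega>. shows_up \<omega> k i) \<in> measurable G (count_space UNIV)"
    unfolding F_def G_def by (rule measurable_source_algebra_coordinates; simp)+
  have [measurable]: "Z i \<in> borel_measurable F" for i
    unfolding Z_def by measurable
  \<comment> \<open>The number of summands is random, so measurability is checked for each of its
    countably many values.\<close>
  have f: "f \<in> borel_measurable (F \<Otimes>\<^sub>M G)"
    unfolding f_def
  proof (rule measurable_compose_countable[where g = "\<lambda>p. walk_num (fst p) k" and
      f = "\<lambda>n p. \<Sum>i<n. Z i (fst p) * ennreal (exp (\<theta> * h (fst p) (snd p) (walk_time (fst p) k i)))"])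
    show "(\<lambda>p. \<Sum>i<n. Z i (fst p) * ennreal (exp (\<theta> * h (fst p) (snd p) (walk_time (fst p) k i))))
        \<in> borel_measurable (F \<Otimes>\<^sub>M G)" for n
      unfolding h_def by measurable
  qed measurable
  have ind: "indep_set (sets F) (sets G)"
    unfolding F_def G_def using k by (intro indep_source_algebras) auto
  have shows_law: "distr M (count_space UNIV) (\<lambda>\<omega>. shows_up \<omega> k j) = measure_pmf (bernoulli_pmf q)" for j
    using law k unfolding stage2_law_def q_def by blast
  have shows_meas: "(\<lambda>\<omega>. shows_up \<omega> k j) \<in> measurable M (count_space UNIV)" for j
    by (rule stage2_measurable[OF valid law k])
  have shows_ind: "indep_vars (\<lambda>_. count_space UNIV) (\<lambda>j \<omega>. shows_up \<omega> k j) {..<b}"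
    unfolding indep_vars_def2
  proof (intro conjI ballI shows_meas)
    have "indep_sets (source2_events M) {s. source2_day s \<in> {1..horizon P}}"
      using law unfolding stage2_law_def by blast
    then have "indep_sets (source2_events M) (\<Union>j\<in>{..<b}. {Shows_Up k j})"
      by (rule indep_sets_mono_index[rotated]) (use k in auto)
    then have "indep_sets (\<lambda>j. sigma_sets (space M) (\<Union>s\<in>{Shows_Up k j}. source2_events M s)) {..<b}"
      by (rule indep_sets_collect_sigma) (simp_all add: Int_stable_source2_events disjoint_family_on_def del: source2_events.simps)
    then show "indep_sets (\<lambda>j. {(\<lambda>\<omega>. shows_up \<omega> k j) -` A \<inter> space M |A. A \<in> sets (count_space UNIV)}) {..<b}"
    proof (rule indep_sets_mono_sets)
      fix j
      show "{(\<lambda>\<omega>. shows_up \<omega> k j) -` A \<inter> space M |A. A \<in> sets (count_space UNIV)}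
        \<subseteq> sigma_sets (space M) (\<Union>s\<in>{Shows_Up k j}. source2_events M s)"
      proof clarify
        fix A :: "bool set"
        show "(\<lambda>\<omega>. shows_up \<omega> k j) -` A \<inter> space M \<in> sigma_sets (space M) (\<Union>s\<in>{Shows_Up k j}. source2_events M s)"
          by (rule sigma_sets.Basic) (simp add: in_vimage_algebra)
      qed
    qed
  qed
  have inner: "(\<integral>\<^sup>+y. f (x, y) \<partial>M) \<le> (\<Sum>i<walk_num x k. Z i x) * V" for x
  proof -
    note [measurable] = shows_meas
    have mgf: "(\<integral>\<^sup>+y. ennreal (exp (\<theta> * h x y u)) \<partial>M) \<le> V" for u
      unfolding h_def V_def using confirm_rate_bounds[OF k]
      by (intro nn_integral_exp_bernoulli_sum_le[OF shows_ind shows_law _ _ \<theta>]) (simp_all add: q_def)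
    have "(\<integral>\<^sup>+y. f (x, y) \<partial>M) = (\<integral>\<^sup>+y. (\<Sum>i<walk_num x k. Z i x * ennreal (exp (\<theta> * h x y (walk_time x k i)))) \<partial>M)"
      unfolding f_def by simp
    also have "\<dots> = (\<Sum>i<walk_num x k. \<integral>\<^sup>+y. Z i x * ennreal (exp (\<theta> * h x y (walk_time x k i))) \<partial>M)"
      unfolding h_def by (intro nn_integral_sum) measurable
    also have "\<dots> = (\<Sum>i<walk_num x k. Z i x * (\<integral>\<^sup>+y. ennreal (exp (\<theta> * h x y (walk_time x k i))) \<partial>M))"
      unfolding h_def by (intro sum.cong refl nn_integral_cmult) measurable
    also have "\<dots> \<le> (\<Sum>i<walk_num x k. Z i x * V)"
      by (intro sum_mono mult_left_mono mgf) simp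
    finally show ?thesis unfolding sum_distrib_right .
  qed
  have sp: "space F = space M" "space G = space M" unfolding F_def G_def by simp_all
  have Z_meas: "(\<lambda>x. \<Sum>i<walk_num x k. Z i x) \<in> borel_measurable M"
  proof (rule measurable_compose_countable[where g = "\<lambda>x. walk_num x k" and f = "\<lambda>n x. \<Sum>i<n. Z i x"])
    note [measurable] = stage2_measurable[OF valid law k]
    show "(\<lambda>x. \<Sum>i<n. Z i x) \<in> borel_measurable M" for n unfolding Z_def by measurable
    show "(\<lambda>x. walk_num x k) \<in> measurable M (count_space UNIV)" by measurable
  qed
  have "(\<integral>\<^sup>+\<omega>. f (\<omega>, \<omega>) \<partial>M) = (\<integral>\<^sup>+x. \<integral>\<^sup>+y. f (x, y) \<partial>M \<partial>M)"
    by (rule nn_integral_decouple[OF ind sp f])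
  also have "\<dots> \<le> (\<integral>\<^sup>+x. (\<Sum>i<walk_num x k. Z i x) * V \<partial>M)"
    by (intro nn_integral_mono inner)
  also have "\<dots> = (\<integral>\<^sup>+x. (\<Sum>i<walk_num x k. Z i x) \<partial>M) * V"
    by (rule nn_integral_multc[OF Z_meas])
  also have "\<dots> \<le> ennreal (exp a * walk_mass P k 0 v * exp (- (1 - exp (- s) - a) * walk_mass P k v 1)) * V"
    unfolding Z_def walk_mass_def
    by (intro mult_right_mono nn_integral_poisson_arrivals_le[OF arrivals[OF k]] walk_rate_props[OF valid law k] v s a) simp
  also have "\<dots> = ennreal (exp (\<theta>\<^sup>2 * (q * (1 - q) * real b)) *
      (exp a * walk_mass P k 0 v * exp (- (1 - exp (- s) - a) * walk_mass P k v 1)))"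
    unfolding V_def using walk_mass_nonneg[OF k] by (simp add: ennreal_mult'[symmetric] mult.commute)
  finally show ?thesis
    unfolding f_def Z_def h_def fst_conv snd_conv show_up_excess_def q_def .
qed

end

text \<open>Common majorant of both losses: (\<open>\<theta>\<close>, \<open>a\<close>,
  \<open>s\<close>) becomes (\<open>s\<close>, 0, 0) for overbooking and (\<open>- s\<close>,
  \<open>s * \<alpha>\<close>, \<open>s\<close>) for vacancies. The sign of \<open>\<theta>\<close>
  flips because too many show-ups cause the former and too few the latter.\<close>

definition walk_in_exp_sum ::
  "params \<Rightarrow> nat \<Rightarrow> nat \<Rightarrow> real \<Rightarrow> real \<Rightarrow> real \<Rightarrow> stage2 \<Rightarrow> real" where
  "walk_in_exp_sum P k b \<theta> a s \<omega> =
    (\<Sum>i<walk_num \<omega> k. of_bool (walk_time \<omega> k i < confirm_time P) *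
        exp (a * walk_mass P k (walk_time \<omega> k i) 1 - s * real (walk_num \<omega> k - 1 - i)) *
        exp (\<theta> * show_up_excess P \<omega> k b (walk_time \<omega> k i)))"

lemma walk_in_exp_sum_nonneg: "0 \<le> walk_in_exp_sum P k b \<theta> a s \<omega>"
  unfolding walk_in_exp_sum_def by (intro sum_nonneg) auto

lemma ennreal_walk_in_exp_sum:
  "ennreal (walk_in_exp_sum P k b \<theta> a s \<omega>) =
    (\<Sum>i<walk_num \<omega> k. of_bool (walk_time \<omega> k i < confirm_time P) *
        ennreal (exp (a * walk_mass P k (walk_time \<omega> k i) 1 - s * real (walk_num \<omega> k - 1 - i))) *
        ennreal (exp (\<theta> * show_up_excess P \<omega> k b (walk_time \<omega> k i))))"
proof -
  have "of_bool Q * ennreal (exp x) * ennreal (exp y) = ennreal (of_bool Q * exp x * exp y)" for Q x y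
    by (cases Q) (simp_all add: ennreal_mult'[symmetric])
  then show ?thesis unfolding walk_in_exp_sum_def by simp
qed

text \<open>Chernoff's argument: on the event, s * (D - \<alpha> * m) is positive or zero. The stock
  at an arrival before the call is at least the stock at the call, so the decay leaves the sum as a
  deterministic factor.\<close>

lemma overbooking_sum_le_exp:
  fixes \<alpha> s :: real
  assumes s: "0 \<le> s" and \<alpha>: "0 \<le> \<alpha>"
    and mono: "\<And>u. u \<le> confirm_time P \<Longrightarrow> walk_mass P k (confirm_time P) 1 \<le> walk_mass P k u 1"
  shows "(\<Sum>i<walk_num \<omega> k. of_bool (walk_time \<omega> k i < confirm_time P \<and>
      \<alpha> * walk_mass P k (walk_time \<omega> k i) 1 < show_up_excess P \<omega> k b (walk_time \<omega> k i)))
    \<le> exp (- (s * \<alpha> * walk_mass P k (confirm_time P) 1)) * walk_in_exp_sum P k b s 0 0 \<omega>"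
  unfolding walk_in_exp_sum_def sum_distrib_left
proof (rule sum_mono)
  fix i
  define u where "u = walk_time \<omega> k i"
  define D where "D = show_up_excess P \<omega> k b u"
  let ?L = "walk_mass P k (confirm_time P) 1"
  have "of_bool (u < confirm_time P \<and> \<alpha> * walk_mass P k u 1 < D)
    \<le> exp (- (s * \<alpha> * ?L)) * (of_bool (u < confirm_time P) * exp (s * D))"
  proof (cases "u < confirm_time P \<and> \<alpha> * walk_mass P k u 1 < D")
    case True
    then have "\<alpha> * ?L \<le> \<alpha> * walk_mass P k u 1" using mono \<alpha> by (intro mult_left_mono) auto
    then have "s * (\<alpha> * ?L) \<le> s * D" using True s by (intro mult_left_mono) auto
    then have "1 \<le> exp (- (s * \<alpha> * ?L) + s * D)" by (simp add: mult.assoc)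
    then show ?thesis using True unfolding exp_add by simp
  qed auto
  then show "of_bool (walk_time \<omega> k i < confirm_time P \<and>
      \<alpha> * walk_mass P k (walk_time \<omega> k i) 1 < show_up_excess P \<omega> k b (walk_time \<omega> k i)) \<le>
    exp (- (s * \<alpha> * ?L)) * (of_bool (walk_time \<omega> k i < confirm_time P) *
      exp (0 * walk_mass P k (walk_time \<omega> k i) 1 - 0 * real (walk_num \<omega> k - 1 - i)) *
      exp (s * show_up_excess P \<omega> k b (walk_time \<omega> k i)))"
    unfolding u_def D_def by simp
qed

text \<open>The positive part of \<open>y\<close> is at most \<open>exp (s * y) / s\<close>, which
  factors into times and counts on one side and the excess on the other. Here the safety stock has a
  growing exponential; only the expectation over later arrivals compensates it.\<close>

lemma vacancy_sum_le_exp: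
  fixes \<alpha> s :: real
  assumes s: "0 < s"
  shows "(\<Sum>i<walk_num \<omega> k. of_bool (walk_time \<omega> k i < confirm_time P) *
      max 0 (\<alpha> * walk_mass P k (walk_time \<omega> k i) 1 - show_up_excess P \<omega> k b (walk_time \<omega> k i)
        - real (walk_num \<omega> k - 1 - i)))
    \<le> 1 / s * walk_in_exp_sum P k b (- s) (s * \<alpha>) s \<omega>"
  unfolding walk_in_exp_sum_def sum_distrib_left
proof (rule sum_mono)
  fix i
  define u where "u = walk_time \<omega> k i"
  define D where "D = show_up_excess P \<omega> k b u"
  define n where "n = real (walk_num \<omega> k - 1 - i)"
  define y where "y = \<alpha> * walk_mass P k u 1 - D - n"
  have "max 0 y \<le> 1 / s * exp (s * y)"
  proof -
    have "s * y \<le> exp (s * y)" using exp_ge_add_one_self[of "s * y"] by linarith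
    then have "y \<le> 1 / s * exp (s * y)" using s by (simp add: field_simps)
    then show ?thesis using s by simp
  qed
  also have "exp (s * y) = exp (s * \<alpha> * walk_mass P k u 1 - s * n) * exp (- s * D)"
    unfolding exp_add[symmetric] y_def by (simp add: algebra_simps)
  finally have "of_bool (u < confirm_time P) * max 0 y \<le> of_bool (u < confirm_time P) *
      (1 / s * (exp (s * \<alpha> * walk_mass P k u 1 - s * n) * exp (- s * D)))"
    by (rule mult_left_mono) simp
  then show "of_bool (walk_time \<omega> k i < confirm_time P) *
      max 0 (\<alpha> * walk_mass P k (walk_time \<omega> k i) 1 - show_up_excess P \<omega> k b (walk_time \<omega> k i)
        - real (walk_num \<omega> k - 1 - i)) \<le>
    1 / s * (of_bool (walk_time \<omega> k i < confirm_time P) *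
      exp (s * \<alpha> * walk_mass P k (walk_time \<omega> k i) 1 - s * real (walk_num \<omega> k - 1 - i)) *
      exp (- s * show_up_excess P \<omega> k b (walk_time \<omega> k i)))"
    unfolding y_def D_def n_def u_def by (simp only: mult_ac)
qed

section \<open>Expected regret of one day in terms of the tilt\<close>

context
  fixes P :: params and M :: "stage2 measure" and k :: nat
  assumes valid: "valid_params P" and law: "stage2_law P M" and k: "k \<in> {1..horizon P}"
begin

interpretation prob_space M
  using law unfolding stage2_law_def by blast

private lemma walk_mass_meas: "k' \<in> {1..horizon P} \<Longrightarrow> (\<lambda>u. walk_mass P k' u 1) \<in> borel_measurable borel"
  unfolding walk_mass_def by (intro borel_measurable_LBINT_Icc walk_rate_props[OF valid law])

lemma measurable_walk_in_exp_sum: "walk_in_exp_sum P k b \<theta> a s \<in> borel_measurable M"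
  unfolding walk_in_exp_sum_def[abs_def]
proof (rule measurable_compose_countable[where g = "\<lambda>\<omega>. walk_num \<omega> k" and
    f = "\<lambda>n \<omega>. \<Sum>i<n. of_bool (walk_time \<omega> k i < confirm_time P) *
        exp (a * walk_mass P k (walk_time \<omega> k i) 1 - s * real (walk_num \<omega> k - 1 - i)) *
        exp (\<theta> * show_up_excess P \<omega> k b (walk_time \<omega> k i))"])
  note [measurable] = stage2_measurable[OF valid law k] walk_mass_meas[OF k]
  show "(\<lambda>\<omega>. \<Sum>i<n. of_bool (walk_time \<omega> k i < confirm_time P) *
        exp (a * walk_mass P k (walk_time \<omega> k i) 1 - s * real (walk_num \<omega> k - 1 - i)) *
        exp (\<theta> * show_up_excess P \<omega> k b (walk_time \<omega> k i))) \<in> borel_measurable M" for n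
    unfolding show_up_excess_def by measurable
  show "(\<lambda>\<omega>. walk_num \<omega> k) \<in> measurable M (count_space UNIV)" by measurable
qed

text \<open>All points lie in (0,1], so the total is a count on that interval; with exponent 0 the
  product formula gives its mean.\<close>

lemma integrable_walk_num: "integrable M (\<lambda>\<omega>. real (walk_num \<omega> k))"
proof (rule integrableI_nonneg)
  note [measurable] = stage2_measurable[OF valid law k]
  show "(\<lambda>\<omega>. real (walk_num \<omega> k)) \<in> borel_measurable M" by measurable
  have pa: "poisson_arrivals M (\<lambda>\<omega>. walk_num \<omega> k) (\<lambda>i \<omega>. walk_time \<omega> k i) 0 1 (walk_rate P k)"
    using law k unfolding stage2_law_def by blast
  let ?c = "arrivals_in (\<lambda>\<omega>. walk_num \<omega> k) (\<lambda>i \<omega>. walk_time \<omega> k i) 0 1"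
  have "AE \<omega> in M. \<forall>i<walk_num \<omega> k. 0 < walk_time \<omega> k i \<and> walk_time \<omega> k i \<le> 1"
    using pa unfolding poisson_arrivals_def by auto
  then have "AE \<omega> in M. ennreal (real (walk_num \<omega> k)) = ennreal (real (?c \<omega>)) * ennreal (exp (- 0 *
      real (arrivals_in (\<lambda>\<omega>. walk_num \<omega> k) (\<lambda>i \<omega>. walk_time \<omega> k i) 1 1 \<omega>)))"
  proof eventually_elim
    case (elim \<omega>)
    then have "{i. i < walk_num \<omega> k \<and> 0 < walk_time \<omega> k i \<and> walk_time \<omega> k i \<le> 1} = {..<walk_num \<omega> k}" by blast
    then show ?case unfolding arrivals_in_def by simp
  qed
  then have "(\<integral>\<^sup>+\<omega>. ennreal (real (walk_num \<omega> k)) \<partial>M) = ennreal ((LBINT u:{0..1}. walk_rate P k u) *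
      exp (- (1 - exp (- 0)) * (LBINT u:{1..1}. walk_rate P k u)))"
    using nn_integral_poisson_arrivals_product[OF pa walk_rate_props[OF valid law k], of 0 1 0]
    by (subst nn_integral_cong_AE) simp_all
  also have "\<dots> < \<infinity>" by simp
  finally show "(\<integral>\<^sup>+\<omega>. ennreal (real (walk_num \<omega> k)) \<partial>M) < \<infinity>" .
qed simp

text \<open>The condition \<open>s * \<alpha> \<le> 1 - exp (- s)\<close> says that, at the
  exponential scale, later walk-ins make up for the rooms held back as safety stock.\<close>

lemma day_regret_integral_le:
  fixes \<alpha> s :: real and B :: "nat \<Rightarrow> nat"
  assumes \<alpha>: "0 \<le> \<alpha>" and s: "0 < s" "s \<le> 1" and a: "s * \<alpha> \<le> 1 - exp (- s)"
  defines "V \<equiv> confirm_rate P k * (1 - confirm_rate P k) * real (B k)"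
    and "L \<equiv> walk_mass P k (confirm_time P) 1"
    and "regret \<equiv> \<lambda>\<omega>. loss P \<omega> B (dass2 P \<alpha> \<omega> B k) k - loss P \<omega> B (offline_opt P \<omega> B (dass2 P \<alpha> \<omega> B k) k) k"
  shows "integrable M regret"
    and "(\<integral>\<omega>. regret \<omega> \<partial>M) \<le> walk_mass P k 0 (confirm_time P) *
      (over_loss P k * (exp (- (s * \<alpha> * L)) * exp (s\<^sup>2 * V)) +
       revenue P k * (1 / s * (exp (s\<^sup>2 * V) * (exp (s * \<alpha>) * exp (- (1 - exp (- s) - s * \<alpha>) * L)))))"
proof -
  define K where "K = k - 1"
  have kK: "k = Suc K" "K < horizon P" using k by (auto simp: K_def)
  have k1: "1 \<le> k" using k by simp
  have nonneg: "0 \<le> over_loss P k" "0 \<le> revenue P k" "0 \<le> confirm_time P" "confirm_time P \<le> 1"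
    using valid k unfolding valid_params_def by blast+
  define h where "h \<omega> = dass2 P \<alpha> \<omega> B K" for \<omega>
  define z where "z \<omega> = dass2_day P \<alpha> \<omega> k (B k) (room_capacity P \<omega> B (h \<omega>) k)" for \<omega>
  have dass2: "dass2 P \<alpha> \<omega> B k = (h \<omega>)(k := z \<omega>)" for \<omega>
    unfolding h_def z_def kK(1) by (simp add: Let_def)
  have regret: "regret \<omega> = day_loss P \<omega> B (h \<omega>) k (z \<omega>) - loss P \<omega> B (offline_opt P \<omega> B (h \<omega>) k) k" for \<omega>
    unfolding regret_def dass2 loss_upd[OF k1] offline_opt_upd ..
  have h_meas: "Measurable.pred M (\<lambda>\<omega>. take1 (h \<omega> k') i)" "Measurable.pred M (\<lambda>\<omega>. take2 (h \<omega> k') i)" for k' i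
    using measurable_dass2[OF valid law walk_mass_meas, of K \<alpha> B k' i] kK(2) unfolding h_def by auto
  have "k \<le> Suc (horizon P)" using k by simp
  then have c_meas: "(\<lambda>\<omega>. room_capacity P \<omega> B (h \<omega>) k) \<in> borel_measurable M"
    by (intro measurable_room_capacity[OF valid law] h_meas)
  have [measurable]: "(\<lambda>\<omega>. day_loss P \<omega> B (h \<omega>) k (z \<omega>)) \<in> borel_measurable M"
    unfolding z_def
    by (intro measurable_day_loss[OF valid law k] measurable_dass2_day[OF valid law k walk_mass_meas[OF k] c_meas] h_meas)
  have [measurable]: "(\<lambda>\<omega>. loss P \<omega> B (offline_opt P \<omega> B (h \<omega>) k) k) \<in> borel_measurable M"
    by (intro measurable_loss_offline_opt[OF valid law k] h_meas nonneg)
  have regret_meas: "regret \<in> borel_measurable M" unfolding regret by measurable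
  \<comment> \<open>Valid on every path, including those on which no decision is feasible.\<close>
  have abs: "\<bar>regret \<omega>\<bar> \<le> (over_loss P k + revenue P k) * (real (B k) + real (walk_num \<omega> k))" for \<omega>
    unfolding regret offline_opt_def loss_upd[OF k1] by (rule abs_day_loss_diff_le[OF nonneg(1,2)])
  show int: "integrable M regret"
  proof (rule Bochner_Integration.integrable_bound[OF _ regret_meas])
    show "integrable M (\<lambda>\<omega>. (over_loss P k + revenue P k) * (real (B k) + real (walk_num \<omega> k)))"
      using integrable_walk_num by simp
    show "AE \<omega> in M. norm (regret \<omega>) \<le> norm ((over_loss P k + revenue P k) * (real (B k) + real (walk_num \<omega> k)))"
      using abs by (intro AE_I2) (simp add: order.trans[OF _ abs_ge_self])
  qed
  define ca where "ca = over_loss P k * exp (- (s * \<alpha> * L))"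
  define cb where "cb = revenue P k * (1 / s)"
  have ca: "0 \<le> ca" and cb: "0 \<le> cb" unfolding ca_def cb_def using nonneg s by auto
  define Ga where "Ga = walk_in_exp_sum P k (B k) s 0 0"
  define Gb where "Gb = walk_in_exp_sum P k (B k) (- s) (s * \<alpha>) s"
  have [measurable]: "Ga \<in> borel_measurable M" "Gb \<in> borel_measurable M"
    unfolding Ga_def Gb_def by (rule measurable_walk_in_exp_sum)+
  have G0: "0 \<le> Ga \<omega>" "0 \<le> Gb \<omega>" for \<omega> unfolding Ga_def Gb_def by (rule walk_in_exp_sum_nonneg)+
  have mono: "L \<le> walk_mass P k u 1" if "u \<le> confirm_time P" for u
    unfolding L_def walk_mass_def by (rule LBINT_Icc_antimono[OF walk_rate_props[OF valid law k] that])
  have W0: "0 \<le> walk_mass P k 0 (confirm_time P)"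
    unfolding walk_mass_def by (rule LBINT_Icc_nonneg[OF walk_rate_props[OF valid law k]])
  have le: "AE \<omega> in M. regret \<omega> \<le> ca * Ga \<omega> + cb * Gb \<omega>"
    using AE_arrivals_generic[OF valid law]
  proof eventually_elim
    case (elim \<omega>)
    have "0 \<le> room_capacity P \<omega> B (h \<omega>) k"
      unfolding h_def kK(1) by (rule room_capacity_dass2_nonneg[OF valid law \<alpha> kK(2) elim])
    note day_regret_le[OF k1 this nonneg(1,2), of \<alpha>]
    also have "over_loss P k * (\<Sum>i<walk_num \<omega> k. of_bool (walk_time \<omega> k i < confirm_time P \<and>
        \<alpha> * walk_mass P k (walk_time \<omega> k i) 1 < show_up_excess P \<omega> k (B k) (walk_time \<omega> k i))) \<le> ca * Ga \<omega>"
      unfolding ca_def Ga_def mult.assoc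
      using overbooking_sum_le_exp[where s = s and \<alpha> = \<alpha> and P = P and k = k and b = "B k" and \<omega> = \<omega>] s \<alpha> mono nonneg
      by (intro mult_left_mono) (auto simp: L_def mult.assoc)
    also have "revenue P k * (\<Sum>i<walk_num \<omega> k. of_bool (walk_time \<omega> k i < confirm_time P) *
        max 0 (\<alpha> * walk_mass P k (walk_time \<omega> k i) 1 - show_up_excess P \<omega> k (B k) (walk_time \<omega> k i)
          - real (walk_num \<omega> k - 1 - i))) \<le> cb * Gb \<omega>"
      unfolding cb_def Gb_def mult.assoc
      by (intro mult_left_mono vacancy_sum_le_exp s nonneg)
    finally show ?case unfolding regret z_def by simp
  qed
  have exp_bound: "(\<integral>\<^sup>+\<omega>. ennreal (walk_in_exp_sum P k (B k) \<theta> a' s' \<omega>) \<partial>M)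
    \<le> ennreal (exp (\<theta>\<^sup>2 * V) * (exp a' * walk_mass P k 0 (confirm_time P) * exp (- (1 - exp (- s') - a') * L)))"
    if "\<bar>\<theta>\<bar> \<le> 1" "0 \<le> s'" "0 \<le> a'" "a' \<le> 1 - exp (- s')" for \<theta> a' s'
    unfolding ennreal_walk_in_exp_sum V_def L_def
    by (rule nn_integral_walk_ins_excess_le[OF valid law k nonneg(3,4) that])
  define bound where "bound = ca * (exp (s\<^sup>2 * V) * walk_mass P k 0 (confirm_time P)) +
      cb * (exp (s\<^sup>2 * V) * (exp (s * \<alpha>) * walk_mass P k 0 (confirm_time P) * exp (- (1 - exp (- s) - s * \<alpha>) * L)))"
  have bound0: "0 \<le> bound" unfolding bound_def using ca cb W0 by simp
  have "(\<integral>\<^sup>+\<omega>. ennreal (regret \<omega>) \<partial>M) \<le> (\<integral>\<^sup>+\<omega>. ennreal ca * ennreal (Ga \<omega>) + ennreal cb * ennreal (Gb \<omega>) \<partial>M)"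
  proof (rule nn_integral_mono_AE)
    show "AE \<omega> in M. ennreal (regret \<omega>) \<le> ennreal ca * ennreal (Ga \<omega>) + ennreal cb * ennreal (Gb \<omega>)"
      using le
    proof eventually_elim
      case (elim \<omega>)
      have "ennreal ca * ennreal (Ga \<omega>) + ennreal cb * ennreal (Gb \<omega>) = ennreal (ca * Ga \<omega> + cb * Gb \<omega>)"
        using ca cb G0 by (simp add: ennreal_mult ennreal_plus)
      then show ?case using ennreal_leI[OF elim] by simp
    qed
  qed
  also have "\<dots> = ennreal ca * (\<integral>\<^sup>+\<omega>. ennreal (Ga \<omega>) \<partial>M) + ennreal cb * (\<integral>\<^sup>+\<omega>. ennreal (Gb \<omega>) \<partial>M)"
    by (simp add: nn_integral_add nn_integral_cmult)
  also have "\<dots> \<le> ennreal ca * ennreal (exp (s\<^sup>2 * V) * walk_mass P k 0 (confirm_time P)) +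
      ennreal cb * ennreal (exp (s\<^sup>2 * V) * (exp (s * \<alpha>) * walk_mass P k 0 (confirm_time P) * exp (- (1 - exp (- s) - s * \<alpha>) * L)))"
  proof (intro add_mono mult_left_mono)
    show "(\<integral>\<^sup>+\<omega>. ennreal (Ga \<omega>) \<partial>M) \<le> ennreal (exp (s\<^sup>2 * V) * walk_mass P k 0 (confirm_time P))"
      using exp_bound[of s 0 0] s unfolding Ga_def by simp
    show "(\<integral>\<^sup>+\<omega>. ennreal (Gb \<omega>) \<partial>M) \<le> ennreal (exp (s\<^sup>2 * V) *
        (exp (s * \<alpha>) * walk_mass P k 0 (confirm_time P) * exp (- (1 - exp (- s) - s * \<alpha>) * L)))"
      using exp_bound[of "- s" s "s * \<alpha>"] s \<alpha> a unfolding Gb_def by simp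
  qed simp_all
  also have "\<dots> = ennreal bound"
    unfolding bound_def using ca cb W0 by (simp add: ennreal_mult ennreal_plus)
  finally have nn: "(\<integral>\<^sup>+\<omega>. ennreal (regret \<omega>) \<partial>M) \<le> ennreal bound" .
  \<comment> \<open>The regret has no fixed sign; \<open>ennreal\<close> keeps its positive part,
    and dropping the negative part only enlarges the integral.\<close>
  have "(\<integral>\<omega>. regret \<omega> \<partial>M) \<le> enn2real (\<integral>\<^sup>+\<omega>. ennreal (regret \<omega>) \<partial>M)"
    unfolding real_lebesgue_integral_def[OF int] by simp
  also have "\<dots> \<le> bound" using nn bound0 by (rule enn2real_leI[rotated])
  finally show "(\<integral>\<omega>. regret \<omega> \<partial>M) \<le> walk_mass P k 0 (confirm_time P) *
      (over_loss P k * (exp (- (s * \<alpha> * L)) * exp (s\<^sup>2 * V)) +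
       revenue P k * (1 / s * (exp (s\<^sup>2 * V) * (exp (s * \<alpha>) * exp (- (1 - exp (- s) - s * \<alpha>) * L)))))"
    unfolding bound_def ca_def cb_def by (simp add: algebra_simps)
qed

end

section \<open>Choice of the tilt and the constants\<close>

theorem theorem2:
  fixes \<alpha> \<rho> :: real
  assumes "0 < \<alpha>" and "\<alpha> < 1 / 2"
  shows "\<exists>K>0. \<exists>c>0. \<forall>P M1 M2 k \<omega>1.
    valid_params P \<longrightarrow> stage1_law P M1 \<longrightarrow> stage2_law P M2 \<longrightarrow>
    k \<in> {1..horizon P} \<longrightarrow> \<omega>1 \<in> space M1 \<longrightarrow>
    show_up_variance P \<omega>1 k \<le> \<rho> * max 1 (walk_mass P k (confirm_time P) 1) \<longrightarrow>
    (let B = bookings P \<omega>1;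
         regret = (\<lambda>\<omega>. loss P \<omega> B (dass2 P \<alpha> \<omega> B k) k
                       - loss P \<omega> B (offline_opt P \<omega> B (dass2 P \<alpha> \<omega> B k) k) k)
     in integrable M2 regret \<and>
        (\<integral>\<omega>. regret \<omega> \<partial>M2)
          \<le> K * (over_loss P k + revenue P k) * walk_mass P k 0 (confirm_time P)
              * exp (- c * walk_mass P k (confirm_time P) 1))"
proof -
  \<comment> \<open>\<open>R\<close> dominates \<open>\<rho>\<close> and is at least 1, and
    \<open>s\<close> solves \<open>s * R = \<alpha> / 4\<close>, hence \<open>s \<le> 1 / 8\<close>.
    Then s^2 times the variance is at most s^2 * R * (1 + L) = c * (1 + L), where
    \<open>4 * c = s * \<alpha>\<close> is the decay rate for overbooking. In \<open>K\<close> the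
    summands 1 and \<open>1 / s\<close> pay for overbooking and vacancies; \<open>exp 2\<close>
    absorbs every term free of L.\<close>
  define R where "R = \<bar>\<rho>\<bar> + 1"
  define s where "s = \<alpha> / (4 * R)"
  define c where "c = s * \<alpha> / 4"
  define K where "K = exp 2 * (1 + 1 / s)"
  have R: "1 \<le> R" by (simp add: R_def)
  have sR: "s * R = \<alpha> / 4" using R by (simp add: s_def)
  have s0: "0 < s" using assms R by (simp add: s_def)
  have "s * 1 \<le> s * R" using R s0 by (intro mult_left_mono) auto
  then have s8: "s \<le> 1 / 8" using sR assms by linarith
  have c0: "0 < c" using s0 assms by (simp add: c_def)
  have K0: "0 < K" using s0 by (simp add: K_def add_pos_pos)
  have "exp (- s) \<le> 1 + (- s) + (- s)\<^sup>2" using s0 s8 by (intro exp_le_quadratic) auto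
  then have es: "s - s * s \<le> 1 - exp (- s)" by (simp add: power2_eq_square)
  have ss: "s * s \<le> s * (1 / 8)" using s0 s8 by (intro mult_left_mono) auto
  have s\<alpha>: "s * \<alpha> \<le> s * (1 / 2)" using s0 assms by (intro mult_left_mono) auto
  \<comment> \<open>Given Stage I the bookings are constants, so the estimate is proved for a fixed
    \<open>B\<close>.\<close>
  have main: "integrable M2 (\<lambda>\<omega>. loss P \<omega> B (dass2 P \<alpha> \<omega> B k) k
        - loss P \<omega> B (offline_opt P \<omega> B (dass2 P \<alpha> \<omega> B k) k) k) \<and>
      (\<integral>\<omega>. loss P \<omega> B (dass2 P \<alpha> \<omega> B k) k - loss P \<omega> B (offline_opt P \<omega> B (dass2 P \<alpha> \<omega> B k) k) k \<partial>M2)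
        \<le> K * (over_loss P k + revenue P k) * walk_mass P k 0 (confirm_time P)
              * exp (- c * walk_mass P k (confirm_time P) 1)"
    if valid: "valid_params P" and law: "stage2_law P M2" and k: "k \<in> {1..horizon P}"
      and var: "confirm_rate P k * (1 - confirm_rate P k) * real (B k) \<le> \<rho> * max 1 (walk_mass P k (confirm_time P) 1)"
    for P M2 k B
  proof
    let ?V = "confirm_rate P k * (1 - confirm_rate P k) * real (B k)"
    define L where "L = walk_mass P k (confirm_time P) 1"
    have nonneg: "0 \<le> over_loss P k" "0 \<le> revenue P k"
      using valid k unfolding valid_params_def by blast+
    have L: "0 \<le> L" and W: "0 \<le> walk_mass P k 0 (confirm_time P)"
      unfolding L_def walk_mass_def by (rule LBINT_Icc_nonneg[OF walk_rate_props[OF valid law k]])+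
    have a: "s * \<alpha> \<le> 1 - exp (- s)" using es ss s\<alpha> s0 by linarith
    have s1: "s \<le> 1" using s8 by simp
    note regret = day_regret_integral_le[OF valid law k less_imp_le[OF assms(1)] s0 s1 a, of B]
    show "integrable M2 (\<lambda>\<omega>. loss P \<omega> B (dass2 P \<alpha> \<omega> B k) k
        - loss P \<omega> B (offline_opt P \<omega> B (dass2 P \<alpha> \<omega> B k) k) k)"
      by (rule regret(1))
    have "?V \<le> R * (1 + L)"
    proof -
      have "?V \<le> \<rho> * max 1 L" using var unfolding L_def .
      also have "\<dots> \<le> R * max 1 L" by (intro mult_right_mono) (auto simp: R_def)
      also have "\<dots> \<le> R * (1 + L)" using R L by (intro mult_left_mono) auto
      finally show ?thesis .
    qed
    then have "s\<^sup>2 * ?V \<le> s\<^sup>2 * (R * (1 + L))" by (intro mult_left_mono) auto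
    also have "\<dots> = s * (s * R) * (1 + L)" by (simp add: power2_eq_square mult_ac)
    also have "\<dots> = c + c * L" unfolding sR c_def by (simp add: algebra_simps)
    finally have sV: "s\<^sup>2 * ?V \<le> c + c * L" .
    have c_le: "c \<le> s * (1 / 8)" unfolding c_def using s\<alpha> by linarith
    have over: "exp (- (s * \<alpha> * L)) * exp (s\<^sup>2 * ?V) \<le> exp 2 * exp (- c * L)"
    proof -
      \<comment> \<open>The variance uses up one of the four units of \<open>c * L\<close>; of the
        remaining three, one is kept.\<close>
      have "4 * c * L = s * \<alpha> * L" by (simp add: c_def)
      moreover have "0 \<le> c * L" using c0 L by simp
      ultimately have "- (s * \<alpha> * L) + s\<^sup>2 * ?V \<le> 2 + - c * L"
        using sV c_le s8 by linarith
      then show ?thesis unfolding exp_add[symmetric] by simp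
    qed
    have vac: "exp (s\<^sup>2 * ?V) * (exp (s * \<alpha>) * exp (- (1 - exp (- s) - s * \<alpha>) * L)) \<le> exp 2 * exp (- c * L)"
    proof -
      \<comment> \<open>1 - exp (- s) - s * \<alpha> is at least s - s / 8 - s / 2 = 3 * s / 8,
        while 2 * c is at most s / 4. One of the two units of \<open>c * L\<close> pays for the
        variance.\<close>
      have "(2 * c) * L \<le> (1 - exp (- s) - s * \<alpha>) * L"
        using es ss s\<alpha> c_le s0 L by (intro mult_right_mono) linarith+
      then have "s\<^sup>2 * ?V + (s * \<alpha> + - (1 - exp (- s) - s * \<alpha>) * L) \<le> 2 + - c * L"
        using sV c_le s8 s\<alpha> by (simp add: algebra_simps)
      then show ?thesis unfolding exp_add[symmetric] by simp
    qed
    have "(\<integral>\<omega>. loss P \<omega> B (dass2 P \<alpha> \<omega> B k) k - loss P \<omega> B (offline_opt P \<omega> B (dass2 P \<alpha> \<omega> B k) k) k \<partial>M2)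
      \<le> walk_mass P k 0 (confirm_time P) * (over_loss P k * (exp 2 * exp (- c * L)) + revenue P k * (1 / s * (exp 2 * exp (- c * L))))"
    proof (rule order.trans[OF regret(2)])
      show "walk_mass P k 0 (confirm_time P) *
        (over_loss P k * (exp (- (s * \<alpha> * walk_mass P k (confirm_time P) 1)) * exp (s\<^sup>2 * ?V)) +
         revenue P k * (1 / s * (exp (s\<^sup>2 * ?V) * (exp (s * \<alpha>) * exp (- (1 - exp (- s) - s * \<alpha>) * walk_mass P k (confirm_time P) 1)))))
        \<le> walk_mass P k 0 (confirm_time P) * (over_loss P k * (exp 2 * exp (- c * L)) + revenue P k * (1 / s * (exp 2 * exp (- c * L))))"
        using s0 over vac unfolding L_def[symmetric] by (intro mult_left_mono add_mono W nonneg) auto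
    qed
    also have "\<dots> \<le> walk_mass P k 0 (confirm_time P) * (over_loss P k * (K * exp (- c * L)) + revenue P k * (K * exp (- c * L)))"
    proof (intro mult_left_mono add_mono W nonneg)
      have "exp 2 \<le> K" "1 / s * exp 2 \<le> K" unfolding K_def using s0 by (simp_all add: algebra_simps)
      then show "exp 2 * exp (- c * L) \<le> K * exp (- c * L)" "1 / s * (exp 2 * exp (- c * L)) \<le> K * exp (- c * L)"
        unfolding mult.assoc[symmetric, of "1 / s"] by (simp_all only: mult_right_mono exp_ge_zero)
    qed
    also have "\<dots> = K * (over_loss P k + revenue P k) * walk_mass P k 0 (confirm_time P) * exp (- c * L)"
      by (simp add: algebra_simps)
    finally show "(\<integral>\<omega>. loss P \<omega> B (dass2 P \<alpha> \<omega> B k) k - loss P \<omega> B (offline_opt P \<omega> B (dass2 P \<alpha> \<omega> B k) k) k \<partial>M2)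
        \<le> K * (over_loss P k + revenue P k) * walk_mass P k 0 (confirm_time P)
              * exp (- c * walk_mass P k (confirm_time P) 1)"
      unfolding L_def .
  qed
  show ?thesis
  proof (rule exI[of _ K], rule conjI[OF K0], rule exI[of _ c], rule conjI[OF c0], intro allI impI)
    fix P M1 M2 k \<omega>1
    assume "valid_params P" "stage2_law P M2" "k \<in> {1..horizon P}"
      "show_up_variance P \<omega>1 k \<le> \<rho> * max 1 (walk_mass P k (confirm_time P) 1)"
    then show "let B = bookings P \<omega>1;
         regret = (\<lambda>\<omega>. loss P \<omega> B (dass2 P \<alpha> \<omega> B k) k
                       - loss P \<omega> B (offline_opt P \<omega> B (dass2 P \<alpha> \<omega> B k) k) k)
     in integrable M2 regret \<and>
        (\<integral>\<omega>. regret \<omega> \<partial>M2)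
          \<le> K * (over_loss P k + revenue P k) * walk_mass P k 0 (confirm_time P)
              * exp (- c * walk_mass P k (confirm_time P) 1)"
      unfolding Let_def show_up_variance_def by (rule main)
  qed
qed

end
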